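(* Let $X=\{x_1,\ldots,x_n\}$ be a finite metric space ($n\ge 1$) whose zeta matrix $Z_X=(e^{-d_X(x_i,x_j)})_{i,j}$ is invertible, with weighting $w_X$. Let $\bm s=(s_1,\ldots,s_n)\in\mathbb{Z}_{>0}^n$. For $Y$ in the multiplicity stratum $\bm s$ near $X$ with $\det Z_Y\neq 0$, with cluster decomposition $Y=Y_1\sqcup\cdots\sqcup Y_n$ over $X$, let $m_i(Y)=\sum_{y\in Y_i}w_Y(y)$ be the total weight of the $i$th cluster. Then for every $i=1,\ldots,n$, the function $m_i$ has stratified approximate limit $w_X(x_i)$ at $X$ along $\bm s$. Equivalently, for every $\varepsilon>0$, the set of $Y$ in the multiplicity stratum $\bm s$ satisfying $$\max_{1\le i\le n}\Bigl|\sum_{y\in Y_i}w_Y(y)-w_X(x_i)\Bigr|<\varepsilon$$ has relative density one at $X$.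
   Context: For a finite metric space $X=\{x_1,\dots,x_n\}$, the distance matrix is $D_X=(d_X(x_i,x_j))_{i,j}$ and the zeta matrix is $Z_X=(e^{-d_X(x_i,x_j)})_{i,j}$. If $Z_X$ is invertible, the weighting is $w_X=Z_X^{-1}\mathbf 1$, where $\mathbf 1$ is the all-ones column vector; $w_X(x_i)$ is its $i$th entry. For an $n\times n$ matrix $A=(a_{ij})$ and $\bm s\in\mathbb{Z}_{>0}^n$ with $N=\sum_i s_i$, $(A)_{\bm s}$ is the $N\times N$ block matrix whose $(i,j)$ block is the $s_i\times s_j$ matrix with all entries equal to $a_{ij}$. $\mathrm{Sym}_N^0$ is the space of real symmetric $N\times N$ matrices $(d_{ij})$ with zero diagonal, identified with $\mathbb{R}^{N(N-1)/2}$ via the entries $d_{ij}$ with $i<j$ and equipped with Lebesgue measure $\mathrm{vol}$ and Euclidean balls $B_r$ (for a zero-dimensional space, the measure is the unit point mass). $\mathcal{D}_N\subset\mathrm{Sym}_N^0$ is the set of distance matrices of ordered $N$-point metric spaces, i.e. matrices with $d_{ij}>0$ for $i\ne j$ and $d_{ik}\le d_{ij}+d_{jk}$ for all pairwise distinct $i,j,k$. Multiplicity stratum $\bm s$ near $X$: it consists of the $N$-point metric spaces $Y$ (where $N=\sum_i s_i$), sufficiently close to $X$ in the Gromov--Hausdorff metric, whose points split into clusters $Y_1,\dots,Y_n$ with $\#Y_i=s_i$, where $Y_i$ is the set of points of $Y$ close to $x_i$. The points of $Y$ are ordered blockwise (first the $s_1$ points of $Y_1$, then the $s_2$ points of $Y_2$,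 and so on). In these coordinates, the stratum near $X$ is described by the distance matrices $D_Y\in\mathcal{D}_N$ near $(D_X)_{\bm s}$, and $Y_i$ is the set of points of $Y$ indexed by the $i$th block. Stratified approximate limit: a function $F$, defined almost everywhere on this stratum with values in a metric space $(M,d_M)$, has stratified approximate limit $m\in M$ at $X$ along $\bm s$ if for every $\varepsilon>0$ the set $\{D_Y: d_M(F(Y),m)<\varepsilon\}$ has relative density one at $(D_X)_{\bm s}$ inside $\mathcal{D}_N$. Here a measurable subset $E\subset\mathcal{D}_N$ has relative density one at $P=(D_X)_{\bm s}$ inside $\mathcal{D}_N$ if $\mathrm{vol}(E\cap B_r(P))/\mathrm{vol}(\mathcal{D}_N\cap B_r(P))\to 1$ as $r\to 0^+$. A set of spaces $Y$ in the stratum has relative density one at $X$ if the corresponding set of matrices $D_Y$ has relative density one at $(D_X)_{\bm s}$ inside $\mathcal{D}_N$. *)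

theory Defs
  imports
    "HOL-Analysis.Abstract_Metric_Spaces"
    "HOL-Analysis.L2_Norm"
    "HOL-Analysis.Embed_Measure"
    "HOL-Analysis.Lebesgue_Measure"
    "Jordan_Normal_Form.Determinant"
    "Jordan_Normal_Form.Gauss_Jordan_Elimination"
begin

section \<open>Distance matrices, zeta matrices and weightings\<close>

definition dist_matrix :: "('a \<Rightarrow> 'a \<Rightarrow> real) \<Rightarrow> (nat \<Rightarrow> 'a) \<Rightarrow> nat \<Rightarrow> real mat" where
  "dist_matrix d x n = mat n n (\<lambda>(i, j). d (x i) (x j))"

text \<open>The zeta matrix and the weighting depend on a finite metric space only through its
  distance matrix, which is therefore taken as the argument.\<close>

definition zeta_matrix :: "real mat \<Rightarrow> real mat" where
  "zeta_matrix D = map_mat (\<lambda>t. exp (- t)) D"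

text \<open>Only meaningful if the zeta matrix is invertible: otherwise \<^const>\<open>mat_inverse\<close> returns
  \<^const>\<open>None\<close> and the value is unspecified.\<close>

definition weighting :: "real mat \<Rightarrow> real vec" where
  "weighting D = the (mat_inverse (zeta_matrix D)) *\<^sub>v vec (dim_row D) (\<lambda>_. 1)"


section \<open>Blocks\<close>

text \<open>A tuple \<open>(s\<^sub>1, \<dots>, s\<^sub>n)\<close> is a function \<open>s\<close> on indices \<open>0, \<dots>, n - 1\<close>; its
  values at other arguments are irrelevant.\<close>

definition block :: "(nat \<Rightarrow> nat) \<Rightarrow> nat \<Rightarrow> nat set" where
  "block s i = {(\<Sum>j<i. s j)..<(\<Sum>j<Suc i. s j)}"

definition block_index :: "(nat \<Rightarrow> nat) \<Rightarrow> nat \<Rightarrow> nat" where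
  "block_index s k = (THE i. k \<in> block s i)"

definition blow_up :: "(nat \<Rightarrow> nat) \<Rightarrow> 'a mat \<Rightarrow> 'a mat" where
  "blow_up s A =
     mat (\<Sum>i<dim_row A. s i) (\<Sum>i<dim_row A. s i)
       (\<lambda>(k, l). A $$ (block_index s k, block_index s l))"


section \<open>Symmetric matrices with zero diagonal\<close>

definition sym0 :: "nat \<Rightarrow> real mat set" where
  "sym0 N = {A \<in> carrier_mat N N.
     (\<forall>i<N. A $$ (i, i) = 0) \<and> (\<forall>i<N. \<forall>j<N. A $$ (i, j) = A $$ (j, i))}"

definition upper_pairs :: "nat \<Rightarrow> (nat \<times> nat) set" where
  "upper_pairs N = {(i, j). i < j \<and> j < N}"

definition sym0_of_coords :: "nat \<Rightarrow> (nat \<times> nat \<Rightarrow> real) \<Rightarrow> real mat" where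
  "sym0_of_coords N v =
     mat N N (\<lambda>(i, j). if i < j then v (i, j) else if j < i then v (j, i) else 0)"

text \<open>Lebesgue measure on \<^term>\<open>sym0 N\<close>: the completed product measure on the coordinates
  above the diagonal, transported along the bijection \<^term>\<open>sym0_of_coords N\<close>.  For
  \<open>N \<le> 1\<close> the product is empty, and its measure is the unit point mass.\<close>

definition sym0_lebesgue :: "nat \<Rightarrow> real mat measure" where
  "sym0_lebesgue N =
     embed_measure (completion (\<Pi>\<^sub>M p\<in>upper_pairs N. lborel)) (sym0_of_coords N)"

definition sym0_ball :: "nat \<Rightarrow> real mat \<Rightarrow> real \<Rightarrow> real mat set" where
  "sym0_ball N P r = {A \<in> sym0 N. L2_set (\<lambda>p. A $$ p - P $$ p) (upper_pairs N) < r}"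

definition dist_matrices :: "nat \<Rightarrow> real mat set" where
  "dist_matrices N = {A \<in> sym0 N.
     (\<forall>i<N. \<forall>j<N. i \<noteq> j \<longrightarrow> 0 < A $$ (i, j)) \<and>
     (\<forall>i<N. \<forall>j<N. \<forall>k<N. i \<noteq> j \<and> j \<noteq> k \<and> i \<noteq> k \<longrightarrow>
        A $$ (i, k) \<le> A $$ (i, j) + A $$ (j, k))}"


section \<open>Relative density one and stratified approximate limits\<close>

definition rel_density_one :: "nat \<Rightarrow> real mat \<Rightarrow> real mat set \<Rightarrow> bool" where
  "rel_density_one N P E \<longleftrightarrow>
     E \<subseteq> dist_matrices N \<and> E \<in> sets (sym0_lebesgue N) \<and>
     ((\<lambda>r. measure (sym0_lebesgue N) (E \<inter> sym0_ball N P r) /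
           measure (sym0_lebesgue N) (dist_matrices N \<inter> sym0_ball N P r)) \<longlongrightarrow> 1) (at_right 0)"

text \<open>Here \<open>D\<close> is the distance matrix of \<open>X\<close>, and \<open>F\<close> is a partial function of the distance
  matrix of \<open>Y\<close>.  The first conjunct says that \<open>F\<close> is defined almost everywhere on the stratum
  near \<open>X\<close>, that is, on the distance matrices in some ball around the blown-up matrix.\<close>

definition strat_approx_limit ::
    "real mat \<Rightarrow> (nat \<Rightarrow> nat) \<Rightarrow> (real mat \<Rightarrow> 'm::metric_space option) \<Rightarrow> 'm \<Rightarrow> bool" where
  "strat_approx_limit D s F m \<longleftrightarrow>
     (let N = (\<Sum>i<dim_row D. s i); P = blow_up s D in
       (\<exists>r>0. AE A in sym0_lebesgue N.
          A \<in> dist_matrices N \<inter> sym0_ball N P r \<longrightarrow> F A \<noteq> None) \<and>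
       (\<forall>\<epsilon>>0. rel_density_one N P
          {A \<in> dist_matrices N. \<exists>v. F A = Some v \<and> dist v m < \<epsilon>}))"

definition cluster_weight :: "(nat \<Rightarrow> nat) \<Rightarrow> nat \<Rightarrow> real mat \<Rightarrow> real" where
  "cluster_weight s i A = (\<Sum>k\<in>block s i. weighting A $ k)"

end

theory Submission
  imports Defs
begin

text \<open>
  Moving from the blown-up matrix along a ray with direction \<open>e\<close>, the zeta matrix at time \<open>t\<close> has
  entries \<open>z (b k) (b l) exp (- t e k l)\<close>, where \<open>b\<close> sends a point to its cluster and \<open>z\<close> is the zeta
  matrix of \<open>X\<close>.  Fix a representative of every cluster.  Subtracting representative rows and
  columns and dividing the differences of rows by \<open>t\<close> gives an equivalent linear system, whose
  unknowns are the cluster sums of the weighting and the weights of the other points.  As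
  \<open>t \<rightarrow> 0\<close> it converges, and the representative rows of the limit say exactly that the cluster
  sums form the weighting of \<open>X\<close>.  For almost every direction the limit system is nonsingular, so
  the cluster sums converge along almost every ray.  Near the blown-up matrix the distance matrices
  form a cone with nonempty interior, so by scaling and dominated convergence the convergence along
  almost every ray gives relative density one.
\<close>

section \<open>Determinants and linear systems\<close>

lemma mult_mat_vec_index_sum:
  fixes A :: "real mat"
  assumes "A \<in> carrier_mat n n" "v \<in> carrier_vec n" "k < n"
  shows "(A *\<^sub>v v) $ k = (\<Sum>l<n. A $$ (k, l) * v $ l)"
  using assms by (auto simp: scalar_prod_def atLeast0LessThan intro!: sum.cong)

text \<open>Lets nonsingularity be argued with finite sums over coefficient functions, so that the
  row and column operations below never have to be written as matrix products.\<close>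

lemma det_nonzero_iff_kernel_trivial:
  fixes A :: "real mat"
  assumes A: "A \<in> carrier_mat n n"
  shows "det A \<noteq> 0 \<longleftrightarrow>
    (\<forall>v. (\<forall>k<n. (\<Sum>l<n. A $$ (k, l) * v l) = 0) \<longrightarrow> (\<forall>k<n. v k = 0))"
proof
  assume d: "det A \<noteq> 0"
  show "\<forall>v. (\<forall>k<n. (\<Sum>l<n. A $$ (k, l) * v l) = 0) \<longrightarrow> (\<forall>k<n. v k = 0)"
  proof (intro allI impI)
    fix v k assume *: "\<forall>k<n. (\<Sum>l<n. A $$ (k, l) * v l) = 0" and k: "k < n"
    have "A *\<^sub>v vec n v = 0\<^sub>v n"
    proof (rule eq_vecI)
      fix i assume "i < dim_vec (0\<^sub>v n :: real vec)"
      then have i: "i < n" by simp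
      have "(A *\<^sub>v vec n v) $ i = (\<Sum>l<n. A $$ (i, l) * vec n v $ l)"
        by (rule mult_mat_vec_index_sum[OF A _ i]) simp
      also have "\<dots> = (\<Sum>l<n. A $$ (i, l) * v l)" by (intro sum.cong) auto
      finally show "(A *\<^sub>v vec n v) $ i = 0\<^sub>v n $ i" using * i by simp
    qed (use A in simp)
    with d have "vec n v = 0\<^sub>v n"
      unfolding det_0_iff_vec_prod_zero[OF A] using vec_carrier[of n v] by blast
    then have "vec n v $ k = 0\<^sub>v n $ k" by simp
    then show "v k = 0" using k by simp
  qed
next
  assume *: "\<forall>v. (\<forall>k<n. (\<Sum>l<n. A $$ (k, l) * v l) = 0) \<longrightarrow> (\<forall>k<n. v k = 0)"
  show "det A \<noteq> 0"
  proof
    assume "det A = 0"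
    then obtain v where v: "v \<in> carrier_vec n" "v \<noteq> 0\<^sub>v n" "A *\<^sub>v v = 0\<^sub>v n"
      unfolding det_0_iff_vec_prod_zero[OF A] by auto
    have "\<forall>k<n. (\<Sum>l<n. A $$ (k, l) * v $ l) = 0"
      using v(3) by (simp flip: mult_mat_vec_index_sum[OF A v(1)])
    then have "\<forall>k<n. v $ k = 0" using * by blast
    then have "v = 0\<^sub>v n" using v(1) by (intro eq_vecI) auto
    with v(2) show False by simp
  qed
qed

text \<open>Multiplying the system by the adjugate turns the matrix into the scalar
  \<open>det A\<close>. Solutions thereby become rational expressions in the entries, the source of
  both the limits and the measurability below.\<close>

lemma cramer_rule:
  fixes A :: "real mat"
  assumes A: "A \<in> carrier_mat n n"
    and sol: "\<And>k. k < n \<Longrightarrow> (\<Sum>l<n. A $$ (k, l) * v l) = h k" and k: "k < n"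
  shows "det A * v k = (\<Sum>l<n. adj_mat A $$ (k, l) * h l)"
proof -
  note adj = adj_mat[OF A]
  have [simp]: "adj_mat A *\<^sub>v vec n h \<in> carrier_vec n" using adj(1) by (intro mult_mat_vec_carrier) auto
  have Av: "A *\<^sub>v vec n v = vec n h"
  proof (rule eq_vecI)
    fix i assume "i < dim_vec (vec n h)"
    then have i: "i < n" by simp
    have "(A *\<^sub>v vec n v) $ i = (\<Sum>l<n. A $$ (i, l) * vec n v $ l)"
      by (rule mult_mat_vec_index_sum[OF A _ i]) simp
    also have "\<dots> = (\<Sum>l<n. A $$ (i, l) * v l)" by (intro sum.cong) auto
    finally show "(A *\<^sub>v vec n v) $ i = vec n h $ i" using sol[OF i] i by simp
  qed (use A in simp)
  have "det A \<cdot>\<^sub>v vec n v = (det A \<cdot>\<^sub>m 1\<^sub>m n) *\<^sub>v vec n v"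
    by (intro eq_vecI) (auto simp: row_smult)
  also have "\<dots> = adj_mat A *\<^sub>v (A *\<^sub>v vec n v)"
    unfolding adj(3)[symmetric] by (rule assoc_mult_mat_vec[OF adj(1) A]) simp
  finally have "(det A \<cdot>\<^sub>v vec n v) $ k = (adj_mat A *\<^sub>v vec n h) $ k" unfolding Av by simp
  also have "\<dots> = (\<Sum>l<n. adj_mat A $$ (k, l) * vec n h $ l)"
    by (rule mult_mat_vec_index_sum[OF adj(1) _ k]) simp
  also have "\<dots> = (\<Sum>l<n. adj_mat A $$ (k, l) * h l)" by (intro sum.cong) auto
  finally show ?thesis using k by simp
qed

text \<open>The existence half of Cramer's rule: the adjugate formula solves the system because
  \<open>A * adj_mat A\<close> is \<open>det A\<close> times the identity.\<close>

lemma cramer_rule_adj_mat: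
  fixes A :: "real mat"
  assumes A: "A \<in> carrier_mat n n" and "det A \<noteq> 0" and k: "k < n"
  shows "(\<Sum>l<n. A $$ (k, l) * ((\<Sum>m<n. adj_mat A $$ (l, m) * h m) / det A)) = h k"
proof -
  note adj = adj_mat[OF A]
  have *: "(\<Sum>l<n. A $$ (k, l) * adj_mat A $$ (l, m)) = (if k = m then det A else 0)"
    if "m < n" for m
  proof -
    have "(A * adj_mat A) $$ (k, m) = (\<Sum>l<n. A $$ (k, l) * adj_mat A $$ (l, m))"
      using A adj(1) k that by (auto simp: scalar_prod_def atLeast0LessThan intro!: sum.cong)
    then show ?thesis using k that unfolding adj(2) by auto
  qed
  have "(\<Sum>l<n. A $$ (k, l) * (\<Sum>m<n. adj_mat A $$ (l, m) * h m))
      = (\<Sum>m<n. (\<Sum>l<n. A $$ (k, l) * adj_mat A $$ (l, m)) * h m)"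
    unfolding sum_distrib_left sum_distrib_right by (subst sum.swap) (simp add: mult.assoc)
  also have "\<dots> = (\<Sum>m<n. if k = m then det A * h m else 0)"
    by (intro sum.cong) (auto simp: *)
  also have "\<dots> = det A * h k" using k by simp
  finally show ?thesis using \<open>det A \<noteq> 0\<close>
    by (simp flip: sum_divide_distrib)
qed

section \<open>Continuity and measurability of determinants and adjugates\<close>

lemma tendsto_det:
  fixes A :: "'b \<Rightarrow> real mat"
  assumes A: "\<And>t. A t \<in> carrier_mat n n" "L \<in> carrier_mat n n"
    and lim: "\<And>k l. k < n \<Longrightarrow> l < n \<Longrightarrow> ((\<lambda>t. A t $$ (k, l)) \<longlongrightarrow> L $$ (k, l)) F"
  shows "((\<lambda>t. det (A t)) \<longlongrightarrow> det L) F"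
  unfolding det_def'[OF A(1)] det_def'[OF A(2)]
proof (intro tendsto_intros)
  fix p i assume "p \<in> {p. p permutes {0..<n}}" "i \<in> {0..<n}"
  then show "((\<lambda>t. A t $$ (i, p i)) \<longlongrightarrow> L $$ (i, p i)) F"
    by (intro lim) (auto simp: permutes_in_image dest: permutes_in_image[of p _ i])
qed

lemma tendsto_adj_mat:
  fixes A :: "'b \<Rightarrow> real mat"
  assumes A: "\<And>t. A t \<in> carrier_mat n n" "L \<in> carrier_mat n n"
    and lim: "\<And>k l. k < n \<Longrightarrow> l < n \<Longrightarrow> ((\<lambda>t. A t $$ (k, l)) \<longlongrightarrow> L $$ (k, l)) F"
    and "k < n" "l < n"
  shows "((\<lambda>t. adj_mat (A t) $$ (k, l)) \<longlongrightarrow> adj_mat L $$ (k, l)) F"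
proof -
  have [simp]: "dim_row (A t) = n" "dim_col (A t) = n" "dim_row L = n" "dim_col L = n" for t
    using A(1)[of t] A(2) by auto
  have "((\<lambda>t. det (mat_delete (A t) l k)) \<longlongrightarrow> det (mat_delete L l k)) F"
    by (rule tendsto_det[of _ "n - 1"])
      (auto simp: mat_delete_def intro!: lim split: if_splits)
  then show ?thesis using assms(4,5)
    by (auto simp: adj_mat_def cofactor_def intro!: tendsto_intros)
qed

lemma measurable_det:
  fixes A :: "'b \<Rightarrow> real mat"
  assumes A: "\<And>x. A x \<in> carrier_mat n n"
    and meas: "\<And>k l. k < n \<Longrightarrow> l < n \<Longrightarrow> (\<lambda>x. A x $$ (k, l)) \<in> borel_measurable M"
  shows "(\<lambda>x. det (A x)) \<in> borel_measurable M"
  unfolding det_def'[OF A(1)]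
proof (intro borel_measurable_sum borel_measurable_times borel_measurable_prod)
  fix p i assume "p \<in> {p. p permutes {0..<n}}" "i \<in> {0..<n}"
  then show "(\<lambda>x. A x $$ (i, p i)) \<in> borel_measurable M"
    by (intro meas) (auto simp: permutes_in_image dest: permutes_in_image[of p _ i])
qed auto

lemma measurable_adj_mat:
  fixes A :: "'b \<Rightarrow> real mat"
  assumes A: "\<And>x. A x \<in> carrier_mat n n"
    and meas: "\<And>k l. k < n \<Longrightarrow> l < n \<Longrightarrow> (\<lambda>x. A x $$ (k, l)) \<in> borel_measurable M"
    and "k < n" "l < n"
  shows "(\<lambda>x. adj_mat (A x) $$ (k, l)) \<in> borel_measurable M"
proof -
  have [simp]: "dim_row (A x) = n" "dim_col (A x) = n" for x
    using A[of x] by auto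
  have "(\<lambda>x. det (mat_delete (A x) l k)) \<in> borel_measurable M"
    by (rule measurable_det[of _ "n - 1"])
      (auto simp: mat_delete_def intro!: meas split: if_splits)
  then show ?thesis using assms(3,4)
    by (auto simp: adj_mat_def cofactor_def)
qed

text \<open>Evaluation at \<open>\<mu>\<close> is a ring homomorphism and commutes with
  determinants, so the determinant is a polynomial in \<open>\<mu>\<close>. Its value at 0 is
  nonzero, hence it has finitely many roots.\<close>

lemma finite_zeros_det_affine:
  fixes a c :: "nat \<Rightarrow> nat \<Rightarrow> real"
  assumes "det (mat n n (\<lambda>(k, l). a k l)) \<noteq> 0"
  shows "finite {\<mu>. det (mat n n (\<lambda>(k, l). a k l + \<mu> * c k l)) = 0}"
proof -
  define p where "p = det (mat n n (\<lambda>(k, l). [:a k l, c k l:]))"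
  have p: "poly p \<mu> = det (mat n n (\<lambda>(k, l). a k l + \<mu> * c k l))" for \<mu>
  proof -
    interpret comm_ring_hom "\<lambda>p. poly p \<mu>" by standard auto
    have "map_mat (\<lambda>p. poly p \<mu>) (mat n n (\<lambda>(k, l). [:a k l, c k l:]))
      = mat n n (\<lambda>(k, l). a k l + \<mu> * c k l)"
      by (intro eq_matI) auto
    then show ?thesis unfolding p_def hom_det[symmetric] by simp
  qed
  have "p \<noteq> 0" using assms p[of 0] by (auto simp del: det_def)
  from poly_roots_finite[OF this] show ?thesis unfolding p .
qed

section \<open>Zeta matrices and the weighting equation\<close>

lemma zeta_matrix_carrier: "A \<in> carrier_mat n n \<Longrightarrow> zeta_matrix A \<in> carrier_mat n n"
  by (simp add: zeta_matrix_def)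

lemma zeta_matrix_index:
  "A \<in> carrier_mat n n \<Longrightarrow> k < n \<Longrightarrow> l < n \<Longrightarrow> zeta_matrix A $$ (k, l) = exp (- A $$ (k, l))"
  by (simp add: zeta_matrix_def)

text \<open>A nonzero determinant makes \<open>mat_inverse\<close> return \<open>Some\<close>, so
  the \<open>the\<close> in \<open>weighting\<close> is meaningful. The limit argument uses the
  weighting only through this equation.\<close>

lemma weighting_equation:
  assumes A: "A \<in> carrier_mat n n" and d: "det (zeta_matrix A) \<noteq> 0" and k: "k < n"
  shows "(\<Sum>l<n. zeta_matrix A $$ (k, l) * weighting A $ l) = 1"
proof -
  let ?Z = "zeta_matrix A" and ?one = "vec n (\<lambda>_. 1) :: real vec"
  note Z = zeta_matrix_carrier[OF A]
  obtain B where B: "mat_inverse ?Z = Some B"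
    using mat_inverse(1)[OF Z] det_non_zero_imp_unit[OF Z d] by fast
  from mat_inverse(2)[OF Z B] have B1: "?Z * B = 1\<^sub>m n" "B \<in> carrier_mat n n" by auto
  have w: "weighting A = B *\<^sub>v ?one" using A B by (simp add: weighting_def)
  have "(\<Sum>l<n. ?Z $$ (k, l) * weighting A $ l) = (?Z *\<^sub>v (B *\<^sub>v ?one)) $ k"
    unfolding w by (rule mult_mat_vec_index_sum[OF Z _ k, symmetric]) (use B1 in auto)
  also have "?Z *\<^sub>v (B *\<^sub>v ?one) = (?Z * B) *\<^sub>v ?one"
    by (rule assoc_mult_mat_vec[OF Z B1(2), symmetric]) simp
  finally show ?thesis using k by (simp add: B1)
qed

lemma weighting_eq_adj_mat:
  assumes A: "A \<in> carrier_mat n n" and d: "det (zeta_matrix A) \<noteq> 0" and k: "k < n"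
  shows "weighting A $ k = (\<Sum>l<n. adj_mat (zeta_matrix A) $$ (k, l)) / det (zeta_matrix A)"
  using cramer_rule[OF zeta_matrix_carrier[OF A] weighting_equation[OF A d] k] d
  by (simp add: field_simps)

lemma det_nonzero_of_invertible_mat:
  fixes A :: "real mat"
  assumes "invertible_mat A" "A \<in> carrier_mat n n"
  shows "det A \<noteq> 0"
proof -
  from assms obtain B where AB: "A * B = 1\<^sub>m n" "B * A = 1\<^sub>m (dim_row B)"
    unfolding invertible_mat_def inverts_mat_def by auto
  \<comment> \<open>\<open>inverts_mat\<close> leaves the dimensions of \<open>B\<close> implicit;
    they are recovered from the two products so that determinants can be multiplied.\<close>
  have "dim_row B = dim_col (B * A)" unfolding AB by simp
  then have "dim_row B = n" using assms(2) by simp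
  moreover have "dim_col B = dim_col (A * B)" by simp
  then have "dim_col B = n" unfolding AB by simp
  ultimately have "B \<in> carrier_mat n n" by auto
  then have "det A * det B = 1" using AB(1) det_one[where 'a = real] by (simp flip: det_mult[OF assms(2)])
  then show ?thesis by auto
qed

section \<open>Lebesgue measure on finite products\<close>

lemma product_sigma_finite_lborel: "product_sigma_finite (\<lambda>_. lborel :: real measure)"
  by standard

lemma measurable_affine_PiM_lborel:
  "(\<lambda>x. \<lambda>p\<in>I. c p + r * x p) \<in> (\<Pi>\<^sub>M p\<in>I. lborel) \<rightarrow>\<^sub>M (\<Pi>\<^sub>M p\<in>I. (lborel :: real measure))"
  by measurable

lemma emeasure_lborel_affine_vimage:
  fixes r c :: real
  assumes "r > 0" "A \<in> sets lborel"
  shows "emeasure lborel A = ennreal r * emeasure lborel ((\<lambda>x. c + r * x) -` A)"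
proof -
  have [measurable]: "A \<in> sets borel" using assms by simp
  have "emeasure lborel A = (\<integral>\<^sup>+x. indicator A x \<partial>lborel)" by simp
  also have "\<dots> = r * (\<integral>\<^sup>+x. indicator A (c + r * x) \<partial>lborel)"
    using assms by (subst nn_integral_real_affine[of _ r c]) auto
  also have "(\<integral>\<^sup>+x. indicator A (c + r * x) \<partial>lborel) = (\<integral>\<^sup>+x. indicator ((\<lambda>x. c + r * x) -` A) x \<partial>lborel)"
    by (intro nn_integral_cong) (simp add: indicator_def)
  also have "\<dots> = emeasure lborel ((\<lambda>x. c + r * x) -` A)"
    using measurable_sets_borel[of "\<lambda>x. c + r * x" borel A] by (intro nn_integral_indicator) simp
  finally show ?thesis .
qed

text \<open>By uniqueness of the product measure it suffices to compare boxes, where the claim is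
  the one-dimensional change of variables in each coordinate. The case \<open>r = 1\<close> is
  translation invariance; general \<open>r\<close> rescales balls.\<close>

lemma emeasure_PiM_lborel_affine:
  fixes r :: real
  assumes I: "finite I" and r: "r > 0" and S: "S \<in> sets (\<Pi>\<^sub>M p\<in>I. lborel)"
  shows "emeasure (\<Pi>\<^sub>M p\<in>I. lborel) S = ennreal (r ^ card I) *
    emeasure (\<Pi>\<^sub>M p\<in>I. lborel) {x \<in> space (\<Pi>\<^sub>M p\<in>I. lborel). (\<lambda>p\<in>I. c p + r * x p) \<in> S}"
proof -
  interpret product_sigma_finite "\<lambda>_. lborel :: real measure" by (rule product_sigma_finite_lborel)
  let ?M = "\<Pi>\<^sub>M p\<in>I. (lborel :: real measure)"
  let ?T = "\<lambda>x. \<lambda>p\<in>I. c p + r * x p"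
  \<comment> \<open>\<open>Q\<close> is the image of the measure under the affine map, with the
    density that should restore Lebesgue measure.\<close>
  define Q where "Q = density (distr ?M ?M ?T) (\<lambda>_. ennreal (r ^ card I))"
  have Q: "emeasure Q A = ennreal (r ^ card I) * emeasure ?M (?T -` A \<inter> space ?M)"
    if "A \<in> sets ?M" for A
    unfolding Q_def using that by (subst emeasure_density) 
      (auto simp: nn_integral_cmult_indicator emeasure_distr[OF measurable_affine_PiM_lborel])
  have "Q = ?M"
  proof (rule PiM_eqI[OF I])
    show "sets Q = sets ?M" unfolding Q_def by simp
    fix A :: "'a \<Rightarrow> real set" assume A: "\<And>i. i \<in> I \<Longrightarrow> A i \<in> sets lborel"
    have V: "(\<lambda>x. c p + r * x) -` A p \<in> sets lborel" if "p \<in> I" for p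
      using measurable_sets_borel[of "\<lambda>x. c p + r * x" borel "A p"] A[OF that] by simp
    have "emeasure Q (Pi\<^sub>E I A) = ennreal (r ^ card I) * emeasure ?M (?T -` Pi\<^sub>E I A \<inter> space ?M)"
      by (rule Q) (use A I in \<open>auto intro!: sets_PiM_I_finite\<close>)
    also have "?T -` Pi\<^sub>E I A \<inter> space ?M = (\<Pi>\<^sub>E p\<in>I. (\<lambda>x. c p + r * x) -` A p)"
      by (auto simp: space_PiM PiE_iff)
    also have "emeasure ?M \<dots> = (\<Prod>p\<in>I. emeasure lborel ((\<lambda>x. c p + r * x) -` A p))"
      by (rule emeasure_PiM[OF I]) (rule V)
    also have "ennreal (r ^ card I) * \<dots> = (\<Prod>p\<in>I. ennreal r * emeasure lborel ((\<lambda>x. c p + r * x) -` A p))"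
      using r by (simp add: prod.distrib ennreal_power)
    also have "\<dots> = (\<Prod>p\<in>I. emeasure lborel (A p))"
      by (intro prod.cong refl emeasure_lborel_affine_vimage[symmetric] r A)
    finally show "emeasure Q (Pi\<^sub>E I A) = (\<Prod>p\<in>I. emeasure lborel (A p))" .
  qed
  then have "emeasure ?M S = emeasure Q S" by simp
  also have "\<dots> = ennreal (r ^ card I) * emeasure ?M (?T -` S \<inter> space ?M)" by (rule Q[OF S])
  also have "?T -` S \<inter> space ?M = {x \<in> space ?M. ?T x \<in> S}" by auto
  finally show ?thesis .
qed

text \<open>The translates of \<open>S\<close> along \<open>u\<close> all have the measure of \<open>S\<close>; averaged over \<open>t \<in> [0, 1]\<close>,
  their measure vanishes by Fubini.\<close>

lemma null_of_countable_line_sections: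
  fixes u :: "'i \<Rightarrow> real"
  assumes I: "finite I" and S: "S \<in> sets (\<Pi>\<^sub>M p\<in>I. lborel)"
    and lines: "\<And>x. x \<in> space (\<Pi>\<^sub>M p\<in>I. lborel) \<Longrightarrow> countable {t. (\<lambda>p\<in>I. x p + t * u p) \<in> S}"
  shows "S \<in> null_sets (\<Pi>\<^sub>M p\<in>I. lborel)"
proof -
  interpret product_sigma_finite "\<lambda>_. lborel :: real measure" by (rule product_sigma_finite_lborel)
  let ?M = "\<Pi>\<^sub>M p\<in>I. (lborel :: real measure)"
  interpret M: sigma_finite_measure ?M by (rule sigma_finite[OF I])
  interpret pair_sigma_finite lborel ?M ..
  let ?T = "\<lambda>t x. \<lambda>p\<in>I. x p + t * u p"
  note S[measurable]
  have [measurable]: "(\<lambda>z. ?T (fst z) (snd z)) \<in> lborel \<Otimes>\<^sub>M ?M \<rightarrow>\<^sub>M ?M" by measurable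
  \<comment> \<open>The interval has length 1, so averaging the constant
    \<open>emeasure ?M S\<close> over it returns that constant.\<close>
  let ?f = "\<lambda>t x. indicator {0..1::real} t * indicator S (?T t x) :: ennreal"
  have f[measurable]: "case_prod ?f \<in> borel_measurable (lborel \<Otimes>\<^sub>M ?M)"
    unfolding case_prod_beta by measurable
  have Tt: "(\<integral>\<^sup>+x. indicator S (?T t x) \<partial>?M) = emeasure ?M S" for t
  proof -
    have [measurable]: "?T t \<in> ?M \<rightarrow>\<^sub>M ?M" by measurable
    have "(\<integral>\<^sup>+x. indicator S (?T t x) \<partial>?M) = (\<integral>\<^sup>+x. indicator {x \<in> space ?M. ?T t x \<in> S} x \<partial>?M)"
      by (intro nn_integral_cong) (simp add: indicator_def)
    also have "\<dots> = emeasure ?M {x \<in> space ?M. ?T t x \<in> S}"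
      by (rule nn_integral_indicator) measurable
    also have "\<dots> = emeasure ?M S"
      using emeasure_PiM_lborel_affine[OF I _ S, of 1 "\<lambda>p. t * u p"] by (simp add: add.commute)
    finally show ?thesis .
  qed
  have "emeasure ?M S = (\<integral>\<^sup>+t. indicator {0..1::real} t * emeasure ?M S \<partial>lborel)"
    by (subst nn_integral_multc) auto
  also have "\<dots> = (\<integral>\<^sup>+t. (\<integral>\<^sup>+x. ?f t x \<partial>?M) \<partial>lborel)"
    by (intro nn_integral_cong) (simp add: nn_integral_cmult Tt)
  also have "\<dots> = (\<integral>\<^sup>+x. (\<integral>\<^sup>+t. ?f t x \<partial>lborel) \<partial>?M)"
    by (rule Fubini'[OF f, symmetric])
  also have "\<dots> = (\<integral>\<^sup>+x. 0 \<partial>?M)"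
  proof (intro nn_integral_cong)
    fix x assume "x \<in> space ?M"
    from countable_imp_null_set_lborel[OF lines[OF this]]
    have "AE t in lborel. ?f t x = 0"
      by (rule AE_I') (auto simp: indicator_def)
    then have "(\<integral>\<^sup>+t. ?f t x \<partial>lborel) = (\<integral>\<^sup>+t. 0 \<partial>(lborel :: real measure))" by (rule nn_integral_cong_AE)
    then show "(\<integral>\<^sup>+t. ?f t x \<partial>lborel) = 0" by simp
  qed
  finally show ?thesis using S by (auto simp: null_sets_def)
qed

section \<open>Blowing up a set at a point\<close>

lemma measurable_L2_set_PiM:
  "finite I \<Longrightarrow> (\<lambda>x. L2_set (\<lambda>p. x p - c p) I) \<in> borel_measurable (\<Pi>\<^sub>M p\<in>I. (lborel :: real measure))"
  unfolding L2_set_def by measurable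

lemma emeasure_PiM_L2_ball_finite:
  assumes I: "finite I"
  shows "emeasure (\<Pi>\<^sub>M p\<in>I. lborel) {x \<in> space (\<Pi>\<^sub>M p\<in>I. lborel). L2_set x I < 1} < \<infinity>"
proof -
  interpret product_sigma_finite "\<lambda>_. lborel :: real measure" by (rule product_sigma_finite_lborel)
  let ?M = "\<Pi>\<^sub>M p\<in>I. (lborel :: real measure)"
  have "{x \<in> space ?M. L2_set x I < 1} \<subseteq> (\<Pi>\<^sub>E p\<in>I. {-1..1})"
  proof
    fix x assume x: "x \<in> {x \<in> space ?M. L2_set x I < 1}"
    have "L2_set (\<lambda>p. \<bar>x p\<bar>) I = L2_set x I" by (simp add: L2_set_def)
    then have "x p \<in> {-1..1}" if "p \<in> I" for p
      using member_le_L2_set[OF I that, of "\<lambda>p. \<bar>x p\<bar>"] x by (auto simp: abs_le_iff)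
    then show "x \<in> (\<Pi>\<^sub>E p\<in>I. {-1..1})" using x by (auto simp: space_PiM PiE_iff)
  qed
  then have "emeasure ?M {x \<in> space ?M. L2_set x I < 1} \<le> emeasure ?M (\<Pi>\<^sub>E p\<in>I. {-1..1})"
    by (rule emeasure_mono) (use I in \<open>auto intro!: sets_PiM_I_finite\<close>)
  also have "\<dots> = (\<Prod>p\<in>I. emeasure lborel {-1..1::real})" by (rule emeasure_PiM[OF I]) simp
  also have "\<dots> < \<infinity>" by (simp add: ennreal_power[symmetric] power_less_top_ennreal)
  finally show ?thesis .
qed

text \<open>Substituting \<open>y = c + r x\<close> turns the ball of radius \<open>r\<close> into
  the unit ball and pulls out \<open>r ^ card I\<close>. The indicators of the rescaled sets
  converge almost everywhere to that of \<open>C\<close> and are dominated by that of the unit ball.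
  Here \<open>C\<close> plays the role of the tangent cone of \<open>S\<close> at
  \<open>c\<close>.\<close>

lemma measure_L2_ball_blow_up:
  assumes I: "finite I" and S: "S \<in> sets (\<Pi>\<^sub>M p\<in>I. lborel)" and C: "C \<in> sets (\<Pi>\<^sub>M p\<in>I. lborel)"
    and cone: "AE x in \<Pi>\<^sub>M p\<in>I. lborel.
      \<forall>\<^sub>F r in at_right 0. (\<lambda>p\<in>I. c p + r * x p) \<in> S \<longleftrightarrow> x \<in> C"
  shows "((\<lambda>r. measure (\<Pi>\<^sub>M p\<in>I. lborel) {y \<in> S. L2_set (\<lambda>p. y p - c p) I < r} / r ^ card I)
    \<longlongrightarrow> measure (\<Pi>\<^sub>M p\<in>I. lborel) {x \<in> C. L2_set x I < 1}) (at_right (0::real))"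
proof -
  let ?M = "\<Pi>\<^sub>M p\<in>I. (lborel :: real measure)"
  let ?T = "\<lambda>r x. \<lambda>p\<in>I. c p + r * x p"
  let ?B = "{x \<in> space ?M. L2_set x I < 1}"
  note [measurable] = S C
  have Tm[measurable]: "?T r \<in> ?M \<rightarrow>\<^sub>M ?M" for r by (rule measurable_affine_PiM_lborel)
  have L2m[measurable]: "(\<lambda>x. L2_set (\<lambda>p. x p - a p) I) \<in> borel_measurable ?M" for a
    by (rule measurable_L2_set_PiM[OF I])
  have L2m0[measurable]: "(\<lambda>x. L2_set x I) \<in> borel_measurable ?M" using L2m[of "\<lambda>_. 0"] by simp
  define U where "U r = {x \<in> space ?M. ?T r x \<in> S \<and> L2_set x I < 1}" for r
  have U[measurable]: "U r \<in> sets ?M" for r unfolding U_def by measurable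
  have B[measurable]: "?B \<in> sets ?M" by measurable
  have scale: "measure ?M {y \<in> S. L2_set (\<lambda>p. y p - c p) I < r} / r ^ card I = measure ?M (U r)"
    if r: "r > 0" for r
  proof -
    have "{y \<in> S. L2_set (\<lambda>p. y p - c p) I < r} = {y \<in> space ?M. y \<in> S \<and> L2_set (\<lambda>p. y p - c p) I < r}"
      using sets.sets_into_space[OF S] by auto
    also have "\<dots> \<in> sets ?M" by measurable
    finally have "{y \<in> S. L2_set (\<lambda>p. y p - c p) I < r} \<in> sets ?M" .
    from emeasure_PiM_lborel_affine[OF I r this, of c]
    have "measure ?M {y \<in> S. L2_set (\<lambda>p. y p - c p) I < r} = r ^ card I *
      measure ?M {x \<in> space ?M. ?T r x \<in> {y \<in> S. L2_set (\<lambda>p. y p - c p) I < r}}"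
      using r by (simp add: measure_def enn2real_mult)
    also have "{x \<in> space ?M. ?T r x \<in> {y \<in> S. L2_set (\<lambda>p. y p - c p) I < r}} = U r"
    proof -
      have "L2_set (\<lambda>p. ?T r x p - c p) I = r * L2_set x I" for x
        using r by (subst L2_set_right_distrib) (auto intro!: L2_set_cong)
      then show ?thesis using r unfolding U_def by auto
    qed
    finally show ?thesis using r by simp
  qed
  have lim: "((\<lambda>r. measure ?M (U r)) \<longlongrightarrow> measure ?M {x \<in> C. L2_set x I < 1}) (at_right 0)"
  \<comment> \<open>Dominated convergence is applied along sequences, so the one-sided limit is
    tested on sequences tending to 0.\<close>
  proof (rule tendsto_at_right_sequentially[of 0 1])
    fix R :: "nat \<Rightarrow> real" assume R: "\<And>n. 0 < R n" "R \<longlonglongrightarrow> 0"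
    have flt: "filterlim R (at_right 0) sequentially"
      using R by (auto simp: filterlim_at intro!: always_eventually less_imp_neq[THEN not_sym])
    have CB: "{x \<in> C. L2_set x I < 1} = {x \<in> space ?M. x \<in> C \<and> L2_set x I < 1}"
      using sets.sets_into_space[OF C] by auto
    have CB'[measurable]: "{x \<in> C. L2_set x I < 1} \<in> sets ?M" unfolding CB by measurable
    have "(\<lambda>n. \<integral>x. indicator (U (R n)) x \<partial>?M) \<longlonglongrightarrow> (\<integral>x. indicator {x \<in> C. L2_set x I < 1} x \<partial>?M :: real)"
    proof (rule integral_dominated_convergence[where w = "indicator ?B"])
      show "integrable ?M (indicator ?B :: _ \<Rightarrow> real)"
        using emeasure_PiM_L2_ball_finite[OF I] B by (intro integrable_real_indicator) auto
      show "AE x in ?M. (\<lambda>n. indicator (U (R n)) x) \<longlonglongrightarrow> (indicator {x \<in> C. L2_set x I < 1} x :: real)"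
        using cone AE_space
      proof eventually_elim
        fix x assume ev: "\<forall>\<^sub>F r in at_right 0. ?T r x \<in> S \<longleftrightarrow> x \<in> C" and "x \<in> space ?M"
        from eventually_compose_filterlim[OF ev flt]
        have "\<forall>\<^sub>F n in sequentially. ?T (R n) x \<in> S \<longleftrightarrow> x \<in> C" .
        then have "\<forall>\<^sub>F n in sequentially. indicator (U (R n)) x = (indicator {x \<in> C. L2_set x I < 1} x :: real)"
          by eventually_elim (use \<open>x \<in> space ?M\<close> in \<open>auto simp: U_def indicator_def\<close>)
        then show "(\<lambda>n. indicator (U (R n)) x) \<longlonglongrightarrow> (indicator {x \<in> C. L2_set x I < 1} x :: real)"
          by (rule tendsto_eventually)
      qed
    qed (auto simp: U_def indicator_def)
    then show "(\<lambda>n. measure ?M (U (R n))) \<longlonglongrightarrow> measure ?M {x \<in> C. L2_set x I < 1}"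
      using sets.sets_into_space[OF U] sets.sets_into_space[OF CB'] by (simp add: Int_absorb2)
  qed simp
  show ?thesis
    by (rule tendsto_cong[THEN iffD2, OF _ lim])
      (auto simp: eventually_at_right_less scale intro!: eventually_mono[OF eventually_at_right_less[of 0]])
qed

section \<open>Perturbations of a blown-up matrix\<close>

text \<open>The combinatorics of a clustering: \<open>b\<close> gives the cluster of a point and
  \<open>f\<close> the representative of a cluster. Being a representative is later expressed as
  \<open>rep k = k\<close>.\<close>

locale cluster_map =
  fixes N n :: nat and b f :: "nat \<Rightarrow> nat"
  assumes b_less: "k < N \<Longrightarrow> b k < n"
    and f_less: "i < n \<Longrightarrow> f i < N"
    and b_f: "i < n \<Longrightarrow> b (f i) = i"
begin

definition rep :: "nat \<Rightarrow> nat" where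
  "rep k = f (b k)"

lemma rep_less: "k < N \<Longrightarrow> rep k < N"
  by (simp add: rep_def b_less f_less)

lemma b_rep: "k < N \<Longrightarrow> b (rep k) = b k"
  by (simp add: rep_def b_less b_f)

lemma rep_rep: "k < N \<Longrightarrow> rep (rep k) = rep k"
  by (simp add: rep_def b_less b_f)

lemma rep_f: "i < n \<Longrightarrow> rep (f i) = f i"
  by (simp add: rep_def b_f)

lemma inj_on_f: "inj_on f {..<n}"
  by (metis b_f inj_on_inverseI lessThan_iff)

lemma rep_fixpoints: "{l. l < N \<and> rep l = l} = f ` {..<n}"
  using b_less f_less rep_f unfolding rep_def by force

text \<open>The change of unknowns: the entry of a representative becomes the sum over its cluster.\<close>

definition aggregate :: "(nat \<Rightarrow> real) \<Rightarrow> nat \<Rightarrow> real" where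
  "aggregate w l = w l + (\<Sum>m | m < N \<and> rep m \<noteq> m \<and> rep m = l. w m)"

definition reduce_cols :: "(nat \<Rightarrow> nat \<Rightarrow> real) \<Rightarrow> nat \<Rightarrow> nat \<Rightarrow> real" where
  "reduce_cols Z k l = Z k l - (if rep l = l then 0 else Z k (rep l))"

text \<open>At \<open>t = 0\<close> all rows of a cluster coincide, so the differences to the
  representative row vanish to first order. Dividing them by \<open>t\<close> keeps the information
  that would otherwise be lost in the limit.\<close>

definition reduced :: "(nat \<Rightarrow> nat \<Rightarrow> real) \<Rightarrow> real \<Rightarrow> nat \<Rightarrow> nat \<Rightarrow> real" where
  "reduced Z t k l =
     (if rep k = k then reduce_cols Z k l
      else (reduce_cols Z k l - reduce_cols Z (rep k) l) / t)"

lemma aggregate_nonrep: "rep l \<noteq> l \<Longrightarrow> aggregate w l = w l"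
proof -
  assume "rep l \<noteq> l"
  then have "{m. m < N \<and> rep m \<noteq> m \<and> rep m = l} = {}" using rep_rep by auto
  then show ?thesis by (simp add: aggregate_def del: Collect_empty_eq)
qed

lemma aggregate_rep:
  assumes "i < n"
  shows "aggregate w (f i) = (\<Sum>m | m < N \<and> b m = i. w m)"
proof -
  have "{m. m < N \<and> b m = i} = insert (f i) {m. m < N \<and> rep m \<noteq> m \<and> rep m = f i}"
  proof (intro Set.set_eqI iffI)
    fix m assume "m \<in> {m. m < N \<and> b m = i}"
    then show "m \<in> insert (f i) {m. m < N \<and> rep m \<noteq> m \<and> rep m = f i}"
      by (auto simp: rep_def)
  next
    fix m assume "m \<in> insert (f i) {m. m < N \<and> rep m \<noteq> m \<and> rep m = f i}"
    then have "m < N \<and> (m = f i \<or> rep m = f i)" using f_less[OF assms] by auto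
    then show "m \<in> {m. m < N \<and> b m = i}"
      using b_rep[of m] b_f[OF assms] by auto
  qed
  then show ?thesis using rep_f[OF assms] by (simp add: aggregate_def)
qed

text \<open>The column operation and the change of unknowns are inverse to each other: what
  aggregation adds to the representative's unknown is what \<open>reduce_cols\<close> subtracts from
  the other columns.\<close>

lemma sum_reduce_cols_aggregate:
  "(\<Sum>l<N. reduce_cols Z k l * aggregate w l) = (\<Sum>l<N. Z k l * w l)"
proof -
  let ?R = "{m. m < N \<and> rep m \<noteq> m}"
  have agg: "aggregate w l = w l + (\<Sum>m\<in>?R. if rep m = l then w m else 0)" for l
    using sum.inter_filter[of ?R w "\<lambda>m. rep m = l"] unfolding aggregate_def by (simp add: conj_assoc)
  have "(\<Sum>l<N. reduce_cols Z k l * aggregate w l)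
    = (\<Sum>l<N. Z k l * aggregate w l) - (\<Sum>l<N. if rep l \<noteq> l then Z k (rep l) * w l else 0)"
    unfolding sum_subtractf[symmetric]
    by (intro sum.cong) (auto simp: reduce_cols_def aggregate_nonrep algebra_simps)
  also have "(\<Sum>l<N. if rep l \<noteq> l then Z k (rep l) * w l else 0) = (\<Sum>l\<in>?R. Z k (rep l) * w l)"
    using sum.inter_filter[of "{..<N}" "\<lambda>l. Z k (rep l) * w l" "\<lambda>l. rep l \<noteq> l"] by simp
  also have "(\<Sum>l<N. Z k l * aggregate w l) = (\<Sum>l<N. Z k l * w l)
      + (\<Sum>m\<in>?R. \<Sum>l<N. if rep m = l then Z k l * w m else 0)"
    unfolding agg distrib_left sum.distrib sum_distrib_left
    by (subst (2) sum.swap) (auto intro!: sum.cong)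
  also have "(\<Sum>m\<in>?R. \<Sum>l<N. if rep m = l then Z k l * w m else 0) = (\<Sum>m\<in>?R. Z k (rep m) * w m)"
    by (intro sum.cong) (auto simp: rep_less)
  finally show ?thesis by simp
qed

text \<open>The rows undergo the same subtraction and division on the right-hand side. The all-one
  vector of the weighting equation thus becomes 1 at representatives and 0 elsewhere.\<close>

lemma sum_reduced_aggregate:
  "(\<Sum>l<N. reduced Z t k l * aggregate w l) =
     (if rep k = k then \<Sum>l<N. Z k l * w l
      else ((\<Sum>l<N. Z k l * w l) - (\<Sum>l<N. Z (rep k) l * w l)) / t)"
proof (cases "rep k = k")
  case True
  then show ?thesis by (simp add: reduced_def sum_reduce_cols_aggregate)
next
  case False
  then have "(\<Sum>l<N. reduced Z t k l * aggregate w l)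
     = ((\<Sum>l<N. reduce_cols Z k l * aggregate w l) - (\<Sum>l<N. reduce_cols Z (rep k) l * aggregate w l)) / t"
    unfolding sum_subtractf[symmetric] sum_divide_distrib by (simp add: reduced_def algebra_simps)
  with False show ?thesis by (simp add: sum_reduce_cols_aggregate)
qed

text \<open>A kernel vector of \<open>Z\<close> aggregates to a kernel vector of the reduced matrix,
  and aggregation is injective: the entries off the representatives are unchanged, and once these
  vanish the representative entries are too.\<close>

lemma det_nonzero_of_det_reduced:
  assumes "det (mat N N (\<lambda>(k, l). reduced Z t k l)) \<noteq> 0"
  shows "det (mat N N (\<lambda>(k, l). Z k l)) \<noteq> 0"
proof -
  have inj: "\<forall>k<N. v k = 0" if "\<And>k. k < N \<Longrightarrow> (\<Sum>l<N. reduced Z t k l * v l) = 0" for v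
    using assms that unfolding det_nonzero_iff_kernel_trivial[OF mat_carrier] by simp
  have "\<forall>k<N. w k = 0" if w: "\<forall>k<N. (\<Sum>l<N. Z k l * w l) = 0" for w
  proof -
    have 0: "\<forall>k<N. aggregate w k = 0"
      by (rule inj) (auto simp: sum_reduced_aggregate w rep_less)
    have nr: "w k = 0" if "k < N" "rep k \<noteq> k" for k
      using 0 that aggregate_nonrep by auto
    show ?thesis
    proof (intro allI impI)
      fix k assume "k < N"
      then have "w k + (\<Sum>m | m < N \<and> rep m \<noteq> m \<and> rep m = k. w m) = 0"
        using 0 by (simp add: aggregate_def)
      also have "(\<Sum>m | m < N \<and> rep m \<noteq> m \<and> rep m = k. w m) = 0"
        by (intro sum.neutral) (auto simp: nr)
      finally show "w k = 0" by simp
    qed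
  qed
  then show ?thesis unfolding det_nonzero_iff_kernel_trivial[OF mat_carrier] by simp
qed

text \<open>The limit as \<open>t \<rightarrow> 0\<close> of \<^term>\<open>reduced\<close> along the ray with direction \<open>e\<close>.\<close>

definition second_diff :: "(nat \<Rightarrow> nat \<Rightarrow> real) \<Rightarrow> (nat \<Rightarrow> nat \<Rightarrow> real) \<Rightarrow> nat \<Rightarrow> nat \<Rightarrow> real" where
  "second_diff z e k l = - z (b k) (b l) *
     ((e k l - e (rep k) l) - (if rep l = l then 0 else e k (rep l) - e (rep k) (rep l)))"

definition limit_system :: "(nat \<Rightarrow> nat \<Rightarrow> real) \<Rightarrow> (nat \<Rightarrow> nat \<Rightarrow> real) \<Rightarrow> nat \<Rightarrow> nat \<Rightarrow> real" where
  "limit_system z e k l =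
     (if rep k = k then if rep l = l then z (b k) (b l) else 0 else second_diff z e k l)"

text \<open>Representative rows converge by continuity; in the other rows the quotients by
  \<open>t\<close> are difference quotients of exponentials at 0.\<close>

lemma tendsto_reduced:
  assumes "k < N" "l < N"
  shows "((\<lambda>t. reduced (\<lambda>k l. z (b k) (b l) * exp (- (t * e k l))) t k l) \<longlongrightarrow> limit_system z e k l)
    (at_right 0)"
proof -
  have E: "((\<lambda>t. exp (- (t * a))) \<longlongrightarrow> 1) (at_right 0)" for a :: real
    by (rule tendsto_eq_intros refl | simp)+
  have D: "((\<lambda>t. (exp (- (t * a)) - exp (- (t * a'))) / t) \<longlongrightarrow> - (a - a')) (at_right 0)" for a a' :: real
  proof -
    have "((\<lambda>t. exp (- (t * a)) - exp (- (t * a'))) has_real_derivative - (a - a')) (at 0)"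
      by (auto intro!: derivative_eq_intros)
    then have "((\<lambda>t. (exp (- (t * a)) - exp (- (t * a'))) / t) \<longlongrightarrow> - (a - a')) (at 0)"
      by (simp add: has_field_derivative_iff)
    then show ?thesis by (rule filterlim_at_split[THEN iffD1, THEN conjunct2])
  qed
  show ?thesis
  proof (cases "rep k = k")
    case True
    show ?thesis
    proof (cases "rep l = l")
      case True
      have "((\<lambda>t. z (b k) (b l) * exp (- (t * e k l))) \<longlongrightarrow> z (b k) (b l) * 1) (at_right 0)"
        by (intro tendsto_mult tendsto_const E)
      then show ?thesis using True \<open>rep k = k\<close>
        by (simp add: reduced_def reduce_cols_def limit_system_def)
    next
      case False
      have "((\<lambda>t. z (b k) (b l) * exp (- (t * e k l)) - z (b k) (b l) * exp (- (t * e k (rep l))))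
         \<longlongrightarrow> z (b k) (b l) * 1 - z (b k) (b l) * 1) (at_right 0)"
        by (intro tendsto_intros E)
      then show ?thesis using False \<open>rep k = k\<close>
        by (simp add: reduced_def reduce_cols_def limit_system_def b_rep[OF \<open>l < N\<close>])
    qed
  next
    case False
    let ?d = "\<lambda>a a' t. (exp (- (t * a)) - exp (- (t * a'))) / t"
    \<comment> \<open>All four entries involved carry the same factor \<open>z (b k) (b l)\<close>,
      because passing to the representative does not change the cluster.\<close>
    have "((\<lambda>t. z (b k) (b l) * (?d (e k l) (e (rep k) l) t -
        (if rep l = l then 0 else ?d (e k (rep l)) (e (rep k) (rep l)) t)))
      \<longlongrightarrow> z (b k) (b l) * (- (e k l - e (rep k) l) -
        (if rep l = l then 0 else - (e k (rep l) - e (rep k) (rep l))))) (at_right 0)"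
      by (intro tendsto_mult tendsto_diff tendsto_const D) (simp add: D[unfolded minus_diff_eq])
    then show ?thesis using False
      by (cases "rep l = l")
        (simp_all add: reduced_def reduce_cols_def limit_system_def second_diff_def
          b_rep[OF \<open>k < N\<close>] b_rep[OF \<open>l < N\<close>] diff_divide_distrib add_divide_distrib algebra_simps)
  qed
qed

lemma sum_rep_eq: "(\<Sum>l<N. (if rep l = l then g l else 0)) = (\<Sum>j<n. g (f j) :: real)"
proof -
  have "(\<Sum>l<N. (if rep l = l then g l else 0)) = (\<Sum>l\<in>{l. l < N \<and> rep l = l}. g l)"
    using sum.inter_filter[of "{..<N}" g "\<lambda>l. rep l = l"] by simp
  then show ?thesis unfolding rep_fixpoints by (simp add: sum.reindex[OF inj_on_f])
qed

text \<open>In the limit a representative row meets only representative columns, so these rows form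
  a copy of the system of \<open>z\<close>, whatever the direction \<open>e\<close>.\<close>

lemma sum_limit_system_rep_row:
  assumes "i < n"
  shows "(\<Sum>l<N. limit_system z e (f i) l * v l) = (\<Sum>j<n. z i j * v (f j))"
proof -
  have "(\<Sum>l<N. limit_system z e (f i) l * v l)
      = (\<Sum>l<N. if rep l = l then z i (b l) * v l else 0)"
    by (intro sum.cong) (auto simp: limit_system_def rep_f[OF assms] b_f[OF assms])
  also have "\<dots> = (\<Sum>j<n. z i (b (f j)) * v (f j))" by (rule sum_rep_eq)
  finally show ?thesis by (simp add: b_f)
qed

text \<open>The aggregated weights solve the reduced system, whose determinant tends to a nonzero
  limit. Cramer's formula therefore passes to the limit, and the representative rows identify the
  limiting cluster sums with \<open>x\<close>.\<close>

lemma cluster_sums_tendsto: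
  fixes w :: "real \<Rightarrow> nat \<Rightarrow> real"
  defines "Z \<equiv> \<lambda>z e t k l. z (b k) (b l) * exp (- (t * e k l))"
  assumes z: "det (mat n n (\<lambda>(i, j). z i j)) \<noteq> 0"
    and L: "det (mat N N (\<lambda>(k, l). limit_system z e k l)) \<noteq> 0"
    and x: "\<And>i. i < n \<Longrightarrow> (\<Sum>j<n. z i j * x j) = 1"
    and w: "\<And>t k. det (mat N N (\<lambda>(k, l). Z z e t k l)) \<noteq> 0 \<Longrightarrow> k < N
      \<Longrightarrow> (\<Sum>l<N. Z z e t k l * w t l) = 1"
  shows "\<forall>\<^sub>F t in at_right 0. det (mat N N (\<lambda>(k, l). Z z e t k l)) \<noteq> 0" (is ?ev)
    and "i < n \<Longrightarrow> ((\<lambda>t. \<Sum>k | k < N \<and> b k = i. w t k) \<longlongrightarrow> x i) (at_right 0)"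
proof -
  let ?B = "\<lambda>t. mat N N (\<lambda>(k, l). reduced (Z z e t) t k l)"
  let ?L = "mat N N (\<lambda>(k, l). limit_system z e k l)"
  \<comment> \<open>The all-one right-hand side after the representative rows have been subtracted
    from the others.\<close>
  let ?h = "\<lambda>k. if rep k = k then 1 else 0 :: real"
  have BL: "((\<lambda>t. ?B t $$ (k, l)) \<longlongrightarrow> ?L $$ (k, l)) (at_right 0)" if "k < N" "l < N" for k l
    using tendsto_reduced[OF that] that unfolding Z_def by simp
  have detB: "((\<lambda>t. det (?B t)) \<longlongrightarrow> det ?L) (at_right 0)"
    by (rule tendsto_det[OF _ _ BL]) auto
  then have ev: "\<forall>\<^sub>F t in at_right 0. det (?B t) \<noteq> 0"
    using L by (rule tendsto_imp_eventually_ne)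
  then show ?ev by eventually_elim (rule det_nonzero_of_det_reduced)
  assume i: "i < n"
  define c where "c k = (\<Sum>l<N. adj_mat ?L $$ (k, l) * ?h l) / det ?L" for k
  have c: "(\<Sum>l<N. limit_system z e k l * c l) = ?h k" if "k < N" for k
    using cramer_rule_adj_mat[OF mat_carrier L that, of ?h] that unfolding c_def by simp
  \<comment> \<open>Both vectors solve the system of \<open>z\<close> with right-hand side 1;
    nonsingularity of \<open>z\<close> makes them equal.\<close>
  have "(\<Sum>j<n. z k j * (c (f j) - x j)) = 0" if "k < n" for k
    using c[OF f_less[OF that]] x[OF that] rep_f[OF that]
    by (simp add: sum_limit_system_rep_row[OF that] right_diff_distrib sum_subtractf)
  then have cx: "c (f i) = x i"
    using det_nonzero_iff_kernel_trivial[OF mat_carrier, THEN iffD1, OF z, rule_format, of "\<lambda>j. c (f j) - x j" i] i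
    by simp
  have "((\<lambda>t. (\<Sum>l<N. adj_mat (?B t) $$ (f i, l) * ?h l) / det (?B t)) \<longlongrightarrow> c (f i)) (at_right 0)"
    unfolding c_def
    by (intro tendsto_divide tendsto_sum tendsto_mult tendsto_const detB L tendsto_adj_mat[OF _ _ BL])
      (auto simp: f_less i)
  then have "((\<lambda>t. aggregate (w t) (f i)) \<longlongrightarrow> c (f i)) (at_right 0)"
  proof (rule Lim_transform_eventually)
    show "\<forall>\<^sub>F t in at_right 0. (\<Sum>l<N. adj_mat (?B t) $$ (f i, l) * ?h l) / det (?B t) = aggregate (w t) (f i)"
      using ev
    proof eventually_elim
      fix t assume t: "det (?B t) \<noteq> 0"
      note w' = w[OF det_nonzero_of_det_reduced[OF t]]
      have "(\<Sum>l<N. ?B t $$ (k, l) * aggregate (w t) l) = ?h k" if "k < N" for k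
        using that sum_reduced_aggregate[of "Z z e t" t k "w t"] by (simp add: w' rep_less)
      from cramer_rule[OF mat_carrier this f_less[OF i]] t
      show "(\<Sum>l<N. adj_mat (?B t) $$ (f i, l) * ?h l) / det (?B t) = aggregate (w t) (f i)"
        by (simp add: field_simps)
    qed
  qed
  then show "((\<lambda>t. \<Sum>k | k < N \<and> b k = i. w t k) \<longlongrightarrow> x i) (at_right 0)"
    unfolding aggregate_rep[OF i] cx .
qed

text \<open>A direction in which the limit system is visibly nonsingular: for a star whose centre represents
  its cluster, the second differences vanish off the diagonal.\<close>

definition star_height :: "nat \<Rightarrow> real" where
  "star_height k = (if rep k = k then 0 else 1)"

definition star :: "nat \<Rightarrow> nat \<Rightarrow> real" where
  "star k l = (if k = l then 0 else star_height k + star_height l)"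

text \<open>The representative rows and the nonsingularity of \<open>z\<close> make a kernel vector
  vanish at representatives. On the remaining unknowns the other rows are diagonal with entries
  \<open>2 * z (b k) (b k)\<close>.\<close>

lemma limit_system_star_det:
  assumes z: "det (mat n n (\<lambda>(i, j). z i j)) \<noteq> 0" and diag: "\<And>i. i < n \<Longrightarrow> z i i \<noteq> 0"
  shows "det (mat N N (\<lambda>(k, l). limit_system z star k l)) \<noteq> 0"
  unfolding det_nonzero_iff_kernel_trivial[OF mat_carrier]
proof (intro allI impI)
  fix v k
  assume "\<forall>k<N. (\<Sum>l<N. mat N N (\<lambda>(k, l). limit_system z star k l) $$ (k, l) * v l) = 0" and k: "k < N"
  then have v: "(\<Sum>l<N. limit_system z star k l * v l) = 0" if "k < N" for k using that by simp
  have "(\<Sum>j<n. z i j * v (f j)) = 0" if "i < n" for i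
    using v[OF f_less[OF that]] unfolding sum_limit_system_rep_row[OF that] .
  then have vf: "v (f i) = 0" if "i < n" for i
    using det_nonzero_iff_kernel_trivial[OF mat_carrier, THEN iffD1, OF z, rule_format, of "\<lambda>j. v (f j)" i] that
    by simp
  have rep0: "v l = 0" if "l < N" "rep l = l" for l
    using vf[OF b_less[OF that(1)]] that(2) by (simp add: rep_def)
  show "v k = 0"
  proof (cases "rep k = k")
    case False
    have "limit_system z star k l * v l = (if l = k then 2 * z (b k) (b k) * v k else 0)" if l: "l < N" for l
    proof (cases "rep l = l")
      case True
      then show ?thesis using rep0[OF l] False by auto
    next
      case nl: False
      have "rep k \<noteq> l" "k \<noteq> rep l" using rep_rep[OF k] rep_rep[OF l] nl False by auto
      then show ?thesis using False nl rep_rep[OF k] rep_rep[OF l]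
        by (auto simp: limit_system_def second_diff_def star_def star_height_def)
    qed
    then have "(\<Sum>l<N. limit_system z star k l * v l) = 2 * z (b k) (b k) * v k" using k by simp
    then show ?thesis using v[OF k] diag[OF b_less[OF k]] by simp
  qed (rule rep0[OF k])
qed

text \<open>After division of the non-representative rows by \<open>t\<close>, the system is affine in \<open>1 / t\<close> and becomes
  that of the star at \<open>1 / t = 0\<close>.\<close>

lemma limit_system_finite_zeros:
  assumes z: "det (mat n n (\<lambda>(i, j). z i j)) \<noteq> 0" and diag: "\<And>i. i < n \<Longrightarrow> z i i \<noteq> 0"
  shows "finite {t. det (mat N N (\<lambda>(k, l). limit_system z (\<lambda>k l. e k l + t * star k l) k l)) = 0}"
    (is "finite ?A")
proof -
  \<comment> \<open>The rows of representatives do not involve the direction, so only the others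
    receive a correction term.\<close>
  let ?c = "\<lambda>k l. if rep k = k then 0 else second_diff z e k l"
  let ?B = "{\<mu>. det (mat N N (\<lambda>(k, l). limit_system z star k l + \<mu> * ?c k l)) = 0}"
  have lin: "limit_system z (\<lambda>k l. e k l + t * star k l) k l =
      (if rep k = k then 1 else t) * (limit_system z star k l + inverse t * ?c k l)" if "t \<noteq> 0" for t k l
    using that by (cases "rep k = k"; cases "rep l = l") (simp_all add: limit_system_def second_diff_def field_simps)
  have "t = 0 \<or> inverse t \<in> ?B" if "t \<in> ?A" for t
  proof (rule disjCI, rule ccontr)
    assume t: "t \<noteq> 0" and "inverse t \<notin> ?B"
    then have inj: "\<forall>k<N. v k = 0"
      if "\<And>k. k < N \<Longrightarrow> (\<Sum>l<N. (limit_system z star k l + inverse t * ?c k l) * v l) = 0" for v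
      using that unfolding mem_Collect_eq det_nonzero_iff_kernel_trivial[OF mat_carrier] by simp
    have "(\<Sum>l<N. limit_system z (\<lambda>k l. e k l + t * star k l) k l * v l) =
        (if rep k = k then 1 else t) * (\<Sum>l<N. (limit_system z star k l + inverse t * ?c k l) * v l)" for v k
      unfolding lin[OF t] sum_distrib_left by (simp add: mult.assoc)
    note scaled = this
    have "det (mat N N (\<lambda>(k, l). limit_system z (\<lambda>k l. e k l + t * star k l) k l)) \<noteq> 0"
      unfolding det_nonzero_iff_kernel_trivial[OF mat_carrier]
    proof (intro allI impI)
      fix v k
      assume "\<forall>k<N. (\<Sum>l<N. mat N N (\<lambda>(k, l). limit_system z (\<lambda>k l. e k l + t * star k l) k l)
        $$ (k, l) * v l) = 0" and k: "k < N"
      then have *: "(\<Sum>l<N. limit_system z (\<lambda>k l. e k l + t * star k l) k l * v l) = 0" if "k < N" for k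
        using that by simp
      have "(\<Sum>l<N. (limit_system z star k l + inverse t * ?c k l) * v l) = 0" if "k < N" for k
      proof -
        have "(if rep k = k then 1 else t) \<noteq> 0" using t by simp
        then show ?thesis using *[OF that] unfolding scaled mult_eq_0_iff by blast
      qed
      from inj[OF this] k show "v k = 0" by simp
    qed
    with \<open>t \<in> ?A\<close> show False by simp
  qed
  \<comment> \<open>The substitution by \<open>inverse t\<close> says nothing about
    \<open>t = 0\<close>, which is added as one possible extra zero.\<close>
  then have "?A \<subseteq> insert 0 (inverse ` ?B)" using inverse_inverse_eq[symmetric] by blast
  moreover have "finite ?B"
    by (rule finite_zeros_det_affine[OF limit_system_star_det[OF z diag]])
  ultimately show ?thesis by (meson finite_imageI finite_insert finite_subset)
qed

end

section \<open>Relative density of sets of distance matrices\<close>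

abbreviation coords_lborel :: "nat \<Rightarrow> (nat \<times> nat \<Rightarrow> real) measure" where
  "coords_lborel N \<equiv> \<Pi>\<^sub>M p\<in>upper_pairs N. lborel"

lemma finite_upper_pairs: "finite (upper_pairs N)"
  by (rule finite_subset[of _ "{..<N} \<times> {..<N}"]) (auto simp: upper_pairs_def)

lemma sym0_of_coords_carrier: "sym0_of_coords N v \<in> carrier_mat N N"
  by (simp add: sym0_of_coords_def)

lemma sym0_of_coords_index:
  "k < N \<Longrightarrow> l < N \<Longrightarrow> sym0_of_coords N v $$ (k, l) =
    (if k < l then v (k, l) else if l < k then v (l, k) else 0)"
  by (simp add: sym0_of_coords_def)

lemma sym0_of_coords_upper: "p \<in> upper_pairs N \<Longrightarrow> sym0_of_coords N v $$ p = v p"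
  by (auto simp: upper_pairs_def sym0_of_coords_index)

lemma sym0_of_coords_in_sym0: "sym0_of_coords N v \<in> sym0 N"
  by (simp add: sym0_def sym0_of_coords_carrier sym0_of_coords_index)

text \<open>Injectivity can hold only among extensional functions, since values off
  \<open>upper_pairs N\<close> are ignored.\<close>

lemma inj_on_sym0_of_coords: "inj_on (sym0_of_coords N) (space (coords_lborel N))"
proof (rule inj_onI)
  fix v w assume *: "v \<in> space (coords_lborel N)" "w \<in> space (coords_lborel N)"
    "sym0_of_coords N v = sym0_of_coords N w"
  show "v = w"
  proof (rule extensionalityI)
    show "v \<in> extensional (upper_pairs N)" "w \<in> extensional (upper_pairs N)"
      using * by (auto simp: space_PiM PiE_iff)
    show "v p = w p" if "p \<in> upper_pairs N" for p
      using sym0_of_coords_upper[OF that, of v] sym0_of_coords_upper[OF that, of w] *(3) by simp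
  qed
qed

lemma sym0_of_coords_surj:
  assumes "A \<in> sym0 N"
  shows "sym0_of_coords N (restrict (\<lambda>p. A $$ p) (upper_pairs N)) = A"
  using assms by (intro eq_matI) (auto simp: sym0_def sym0_of_coords_def upper_pairs_def not_less)

lemma image_sym0_of_coords:
  assumes "E \<subseteq> sym0 N"
  shows "sym0_of_coords N ` {v \<in> space (coords_lborel N). sym0_of_coords N v \<in> E} = E"
proof
  show "E \<subseteq> sym0_of_coords N ` {v \<in> space (coords_lborel N). sym0_of_coords N v \<in> E}"
  proof
    fix A assume "A \<in> E"
    then have "A \<in> sym0 N" using assms by auto
    note A = sym0_of_coords_surj[OF this]
    show "A \<in> sym0_of_coords N ` {v \<in> space (coords_lborel N). sym0_of_coords N v \<in> E}"
      by (intro image_eqI[where x = "restrict (($$) A) (upper_pairs N)"]) (simp_all add: A \<open>A \<in> E\<close> space_PiM)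
  qed
qed auto

text \<open>The completion contains all sets of the product measure, so measurability can be checked
  below in the uncompleted product.\<close>

lemma sets_sym0_lebesgueI:
  assumes "E \<subseteq> sym0 N" "{v \<in> space (coords_lborel N). sym0_of_coords N v \<in> E} \<in> sets (coords_lborel N)"
  shows "E \<in> sets (sym0_lebesgue N)"
  using in_sets_embed_measure[OF sets_completionI_sets[OF assms(2)], of "sym0_of_coords N"]
  by (simp add: sym0_lebesgue_def image_sym0_of_coords[OF assms(1)])

lemma emeasure_sym0_lebesgue:
  assumes E: "E \<subseteq> sym0 N"
    and V: "{v \<in> space (coords_lborel N). sym0_of_coords N v \<in> E} \<in> sets (coords_lborel N)"
  shows "emeasure (sym0_lebesgue N) E =
    emeasure (coords_lborel N) {v \<in> space (coords_lborel N). sym0_of_coords N v \<in> E}"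
proof -
  have "emeasure (sym0_lebesgue N) E = emeasure (completion (coords_lborel N))
      (sym0_of_coords N -` E \<inter> space (completion (coords_lborel N)))"
    unfolding sym0_lebesgue_def
    by (rule emeasure_embed_measure')
      (use inj_on_sym0_of_coords sets_sym0_lebesgueI[OF E V] in \<open>simp_all add: sym0_lebesgue_def\<close>)
  also have "sym0_of_coords N -` E \<inter> space (completion (coords_lborel N))
      = {v \<in> space (coords_lborel N). sym0_of_coords N v \<in> E}" by auto
  also have "emeasure (completion (coords_lborel N)) \<dots> = emeasure (coords_lborel N) \<dots>"
    using V by simp
  finally show ?thesis .
qed

lemma AE_sym0_lebesgueI:
  assumes "{v \<in> space (coords_lborel N). \<not> Q (sym0_of_coords N v)} \<in> null_sets (coords_lborel N)"
  shows "AE A in sym0_lebesgue N. Q A"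
proof (rule AE_I)
  let ?E = "{A \<in> sym0 N. \<not> Q A}"
  have E: "{v \<in> space (coords_lborel N). sym0_of_coords N v \<in> ?E}
      = {v \<in> space (coords_lborel N). \<not> Q (sym0_of_coords N v)}"
    using sym0_of_coords_in_sym0 by auto
  have V: "{v \<in> space (coords_lborel N). sym0_of_coords N v \<in> ?E} \<in> sets (coords_lborel N)"
    unfolding E using assms by auto
  show "?E \<in> sets (sym0_lebesgue N)" by (rule sets_sym0_lebesgueI[OF _ V]) auto
  have "?E \<subseteq> sym0 N" by auto
  from emeasure_sym0_lebesgue[OF this V] show "emeasure (sym0_lebesgue N) ?E = 0"
    using assms unfolding E by auto
  show "{A \<in> space (sym0_lebesgue N). \<not> Q A} \<subseteq> ?E"
    using sym0_of_coords_in_sym0 by (auto simp: sym0_lebesgue_def space_embed_measure)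
qed

lemma measurable_sym0_of_coords_index[measurable]:
  assumes "k < N" "l < N"
  shows "(\<lambda>v. sym0_of_coords N v $$ (k, l)) \<in> borel_measurable (coords_lborel N)"
proof -
  have "(\<lambda>v. v p) \<in> borel_measurable (coords_lborel N)" if "p \<in> upper_pairs N" for p
    using measurable_component_singleton[OF that, of "\<lambda>_. lborel"] by simp
  then show ?thesis using assms
    by (cases "k < l"; cases "l < k") (simp_all add: sym0_of_coords_index upper_pairs_def)
qed

lemma sym0_of_coords_affine:
  assumes "A \<in> sym0 N" "k < N" "l < N"
  shows "sym0_of_coords N (\<lambda>p\<in>upper_pairs N. A $$ p + r * v p) $$ (k, l) =
    A $$ (k, l) + r * sym0_of_coords N v $$ (k, l)"
  using assms by (auto simp: sym0_of_coords_index upper_pairs_def sym0_def not_less)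

lemma sym0_of_coords_plus:
  assumes "k < N" "l < N"
  shows "sym0_of_coords N (\<lambda>p\<in>upper_pairs N. v p + t * u p) $$ (k, l) =
    sym0_of_coords N v $$ (k, l) + t * sym0_of_coords N u $$ (k, l)"
  using assms by (auto simp: sym0_of_coords_index upper_pairs_def)

section \<open>The set of distance matrices and its tangent cone\<close>

lemma dist_matrices_sub_sym0: "dist_matrices N \<subseteq> sym0 N"
  by (auto simp: dist_matrices_def)

lemma dist_matrices_measurable:
  "{v \<in> space (coords_lborel N). sym0_of_coords N v \<in> dist_matrices N} \<in> sets (coords_lborel N)"
proof -
  have "{v \<in> space (coords_lborel N). sym0_of_coords N v \<in> dist_matrices N} =
    {v \<in> space (coords_lborel N).
      (\<forall>i\<in>{..<N}. \<forall>j\<in>{..<N}. i \<noteq> j \<longrightarrow> 0 < sym0_of_coords N v $$ (i, j)) \<and>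
      (\<forall>i\<in>{..<N}. \<forall>j\<in>{..<N}. \<forall>k\<in>{..<N}. i \<noteq> j \<and> j \<noteq> k \<and> i \<noteq> k \<longrightarrow>
        sym0_of_coords N v $$ (i, k) \<le> sym0_of_coords N v $$ (i, j) + sym0_of_coords N v $$ (j, k))}"
    by (auto simp: dist_matrices_def sym0_of_coords_in_sym0)
  also have "\<dots> \<in> sets (coords_lborel N)"
    by (intro sets.sets_Collect_conj sets.sets_Collect_finite_All sets.sets_Collect_imp
        sets.sets_Collect_const)
      (auto intro!: borel_measurable_le borel_measurable_less borel_measurable_add measurable_sym0_of_coords_index)
  finally show ?thesis .
qed

text \<open>For small \<open>r\<close> a positive \<open>p\<close> outweighs \<open>r * q\<close>,
  while \<open>p = 0\<close> leaves the sign to \<open>q\<close>. This is why only tight constraints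
  survive in the tangent cone.\<close>

lemma eventually_affine_pos_iff:
  fixes p q :: real
  assumes "p \<ge> 0"
  shows "\<forall>\<^sub>F r in at_right 0. 0 < p + r * q \<longleftrightarrow> (p = 0 \<longrightarrow> 0 < q)"
    and "\<forall>\<^sub>F r in at_right 0. 0 \<le> p + r * q \<longleftrightarrow> (p = 0 \<longrightarrow> 0 \<le> q)"
proof -
  have pos: "\<forall>\<^sub>F r in at_right 0. 0 < p + r * q" if "p > 0"
  proof -
    have "((\<lambda>r. p + r * q) \<longlongrightarrow> p + 0 * q) (at_right 0)" by (intro tendsto_intros)
    with that show ?thesis by (auto dest: order_tendstoD(1))
  qed
  have r: "\<forall>\<^sub>F r in at_right (0::real). 0 < r" by (rule eventually_at_right_less)
  show "\<forall>\<^sub>F r in at_right 0. 0 < p + r * q \<longleftrightarrow> (p = 0 \<longrightarrow> 0 < q)"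
  proof (cases "p = 0")
    case True
    show ?thesis using r by eventually_elim (simp add: True zero_less_mult_iff)
  next
    case False
    with assms have "p > 0" by simp
    from pos[OF this] show ?thesis by eventually_elim (simp add: False)
  qed
  show "\<forall>\<^sub>F r in at_right 0. 0 \<le> p + r * q \<longleftrightarrow> (p = 0 \<longrightarrow> 0 \<le> q)"
  proof (cases "p = 0")
    case True
    show ?thesis using r by eventually_elim (simp add: True zero_le_mult_iff)
  next
    case False
    with assms have "p > 0" by simp
    from pos[OF this] show ?thesis by eventually_elim (simp add: False)
  qed
qed

text \<open>The tangent cone at \<open>P\<close>: only the constraints that are tight at \<open>P\<close> restrict the direction.\<close>

definition dist_matrix_directions :: "nat \<Rightarrow> real mat \<Rightarrow> real mat set" where
  "dist_matrix_directions N P = {A.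
     (\<forall>i<N. \<forall>j<N. i \<noteq> j \<longrightarrow> P $$ (i, j) = 0 \<longrightarrow> 0 < A $$ (i, j)) \<and>
     (\<forall>i<N. \<forall>j<N. \<forall>k<N. i \<noteq> j \<and> j \<noteq> k \<and> i \<noteq> k \<longrightarrow> P $$ (i, j) + P $$ (j, k) - P $$ (i, k) = 0 \<longrightarrow>
        0 \<le> A $$ (i, j) + A $$ (j, k) - A $$ (i, k))}"

lemma dist_matrix_directions_measurable:
  "{v \<in> space (coords_lborel N). sym0_of_coords N v \<in> dist_matrix_directions N P} \<in> sets (coords_lborel N)"
proof -
  have "{v \<in> space (coords_lborel N). sym0_of_coords N v \<in> dist_matrix_directions N P} =
    {v \<in> space (coords_lborel N).
      (\<forall>i\<in>{..<N}. \<forall>j\<in>{..<N}. i \<noteq> j \<longrightarrow> P $$ (i, j) = 0 \<longrightarrow> 0 < sym0_of_coords N v $$ (i, j)) \<and>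
      (\<forall>i\<in>{..<N}. \<forall>j\<in>{..<N}. \<forall>k\<in>{..<N}. i \<noteq> j \<and> j \<noteq> k \<and> i \<noteq> k \<longrightarrow>
        P $$ (i, j) + P $$ (j, k) - P $$ (i, k) = 0 \<longrightarrow>
        0 \<le> sym0_of_coords N v $$ (i, j) + sym0_of_coords N v $$ (j, k) - sym0_of_coords N v $$ (i, k))}"
    by (auto simp: dist_matrix_directions_def)
  also have "\<dots> \<in> sets (coords_lborel N)"
    by (intro sets.sets_Collect_conj sets.sets_Collect_finite_All sets.sets_Collect_imp
        sets.sets_Collect_const)
      (auto intro!: borel_measurable_le borel_measurable_less borel_measurable_add borel_measurable_diff measurable_sym0_of_coords_index)
  finally show ?thesis .
qed

text \<open>Finitely many constraints define a distance matrix, each affine in \<open>r\<close>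
  along the ray and nonnegative at \<open>r = 0\<close>; small \<open>r\<close> settles them all at
  once.\<close>

lemma eventually_dist_matrices_iff:
  assumes P: "P \<in> sym0 N" and nonneg: "\<And>i j. i < N \<Longrightarrow> j < N \<Longrightarrow> 0 \<le> P $$ (i, j)"
    and tri: "\<And>i j k. i < N \<Longrightarrow> j < N \<Longrightarrow> k < N \<Longrightarrow> P $$ (i, k) \<le> P $$ (i, j) + P $$ (j, k)"
  shows "\<forall>\<^sub>F r in at_right 0.
    sym0_of_coords N (\<lambda>p\<in>upper_pairs N. P $$ p + r * v p) \<in> dist_matrices N \<longleftrightarrow>
    sym0_of_coords N v \<in> dist_matrix_directions N P"
proof -
  let ?A = "sym0_of_coords N v"
  have "\<forall>\<^sub>F r in at_right 0. \<forall>i\<in>{..<N}. \<forall>j\<in>{..<N}.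
      0 < P $$ (i, j) + r * ?A $$ (i, j) \<longleftrightarrow> (P $$ (i, j) = 0 \<longrightarrow> 0 < ?A $$ (i, j))"
    by (intro eventually_ball_finite ballI eventually_affine_pos_iff nonneg) auto
  moreover have "\<forall>\<^sub>F r in at_right 0. \<forall>i\<in>{..<N}. \<forall>j\<in>{..<N}. \<forall>k\<in>{..<N}.
      0 \<le> (P $$ (i, j) + P $$ (j, k) - P $$ (i, k)) + r * (?A $$ (i, j) + ?A $$ (j, k) - ?A $$ (i, k)) \<longleftrightarrow>
        (P $$ (i, j) + P $$ (j, k) - P $$ (i, k) = 0 \<longrightarrow> 0 \<le> ?A $$ (i, j) + ?A $$ (j, k) - ?A $$ (i, k))"
    using tri by (intro eventually_ball_finite ballI eventually_affine_pos_iff) auto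
  ultimately show ?thesis
  proof eventually_elim
    case (elim r)
    have "a + r * b \<le> (a' + r * b') + (a'' + r * b'') \<longleftrightarrow> 0 \<le> (a' + a'' - a) + r * (b' + b'' - b)"
      for a b a' b' a'' b'' :: real by (simp add: algebra_simps)
    with elim show ?case
      by (simp add: dist_matrices_def dist_matrix_directions_def sym0_of_coords_in_sym0
          sym0_of_coords_affine[OF P])
  qed
qed

text \<open>Directions with all off-diagonal entries between \<open>a\<close> and
  \<open>2 * a\<close> satisfy every constraint whatever \<open>P\<close> is, so the cone contains
  an open box. Positivity permits division by this limit of the denominators.\<close>

lemma dist_matrix_directions_ball_pos:
  "measure (coords_lborel N) {v \<in> {v \<in> space (coords_lborel N).
     sym0_of_coords N v \<in> dist_matrix_directions N P}. L2_set v (upper_pairs N) < 1} > 0"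
proof -
  interpret product_sigma_finite "\<lambda>_. lborel :: real measure" by (rule product_sigma_finite_lborel)
  let ?M = "coords_lborel N" and ?I = "upper_pairs N"
  let ?C = "{v \<in> {v \<in> space ?M. sym0_of_coords N v \<in> dist_matrix_directions N P}. L2_set v ?I < 1}"
  note I = finite_upper_pairs[of N]
  \<comment> \<open>The sum of the entries is below \<open>card ?I * 2 * a < 1\<close> if there are
    any pairs, which puts the box in the unit ball; the added 1 keeps \<open>a\<close> positive when
    there are none.\<close>
  define a where "a = 1 / (2 * (real (card ?I) + 1))"
  have a: "a > 0" unfolding a_def by (simp add: add_nonneg_pos)
  let ?box = "\<Pi>\<^sub>E p\<in>?I. {a<..<2 * a}"
  have [measurable]: "(\<lambda>x. L2_set x ?I) \<in> borel_measurable ?M"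
    using measurable_L2_set_PiM[OF I, of "\<lambda>_. 0"] by simp
  note dist_matrix_directions_measurable[of N P, measurable]
  have "?C = {v \<in> space ?M. v \<in> {v \<in> space ?M. sym0_of_coords N v \<in> dist_matrix_directions N P} \<and> L2_set v ?I < 1}"
    by auto
  also have "\<dots> \<in> sets ?M" by measurable
  finally have C: "?C \<in> sets ?M" .
  \<comment> \<open>any three numbers in \<open>{a<..<2 * a}\<close> satisfy the triangle inequality\<close>
  have sub: "?box \<subseteq> ?C"
  proof
    fix v assume v: "v \<in> ?box"
    then have vb: "a < v p" "v p < 2 * a" if "p \<in> ?I" for p using that by (auto simp: PiE_iff)
    have e: "a < sym0_of_coords N v $$ (i, j) \<and> sym0_of_coords N v $$ (i, j) < 2 * a"
      if "i < N" "j < N" "i \<noteq> j" for i j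
      using that vb[of "(i, j)"] vb[of "(j, i)"]
      by (cases "i < j") (auto simp: sym0_of_coords_index upper_pairs_def)
    have "L2_set v ?I \<le> (\<Sum>p\<in>?I. \<bar>v p\<bar>)" by (rule L2_set_le_sum_abs)
    also have "\<dots> \<le> (\<Sum>p\<in>?I. 2 * a)" using vb a by (intro sum_mono) (fastforce simp: abs_le_iff)
    also have "\<dots> < 1" by (simp add: a_def field_simps)
    finally have "L2_set v ?I < 1" .
    moreover have "sym0_of_coords N v \<in> dist_matrix_directions N P"
    proof -
      have "0 < sym0_of_coords N v $$ (i, j)" if "i < N" "j < N" "i \<noteq> j" for i j
        using e[OF that] a by linarith
      moreover have "0 \<le> sym0_of_coords N v $$ (i, j) + sym0_of_coords N v $$ (j, k) - sym0_of_coords N v $$ (i, k)"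
        if "i < N" "j < N" "k < N" "i \<noteq> j" "j \<noteq> k" "i \<noteq> k" for i j k
        using e[of i j] e[of j k] e[of i k] that by linarith
      ultimately show ?thesis by (simp add: dist_matrix_directions_def)
    qed
    moreover have "v \<in> space ?M" using v by (auto simp: space_PiM PiE_iff)
    ultimately show "v \<in> ?C" by simp
  qed
  have "emeasure ?M ?box = (\<Prod>p\<in>?I. emeasure lborel {a<..<2 * a})"
    by (rule emeasure_PiM[OF I]) simp
  also have "\<dots> > 0" using a by (simp add: ennreal_power)
  finally have "emeasure ?M ?C > 0" using emeasure_mono[OF sub C] by order
  moreover have "emeasure ?M ?C < \<infinity>"
  proof -
    have "?C \<subseteq> {x \<in> space ?M. L2_set x ?I < 1}" by auto
    then have "emeasure ?M ?C \<le> emeasure ?M {x \<in> space ?M. L2_set x ?I < 1}"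
      by (rule emeasure_mono) measurable
    also have "\<dots> < \<infinity>" by (rule emeasure_PiM_L2_ball_finite[OF I])
    finally show ?thesis .
  qed
  ultimately show ?thesis by (simp add: measure_def enn2real_positive_iff)
qed

text \<open>By the hypothesis on rays, \<open>E\<close> and the set of all distance matrices have
  the same blow-up at \<open>P\<close>. After division by the same power of \<open>r\<close>,
  numerator and denominator tend to the same positive number.\<close>

lemma rel_density_oneI:
  assumes P: "P \<in> sym0 N" and nonneg: "\<And>i j. i < N \<Longrightarrow> j < N \<Longrightarrow> 0 \<le> P $$ (i, j)"
    and tri: "\<And>i j k. i < N \<Longrightarrow> j < N \<Longrightarrow> k < N \<Longrightarrow> P $$ (i, k) \<le> P $$ (i, j) + P $$ (j, k)"
    and E: "E \<subseteq> dist_matrices N"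
    and meas: "{v \<in> space (coords_lborel N). sym0_of_coords N v \<in> E} \<in> sets (coords_lborel N)"
    and ray: "AE v in coords_lborel N. \<forall>\<^sub>F r in at_right 0.
      sym0_of_coords N (\<lambda>p\<in>upper_pairs N. P $$ p + r * v p) \<in> dist_matrices N \<longrightarrow>
      sym0_of_coords N (\<lambda>p\<in>upper_pairs N. P $$ p + r * v p) \<in> E"
  shows "rel_density_one N P E"
proof -
  let ?M = "coords_lborel N" and ?I = "upper_pairs N" and ?f = "sym0_of_coords N"
  let ?T = "\<lambda>r v. \<lambda>p\<in>?I. P $$ p + r * v p"
  let ?C = "{v \<in> space ?M. ?f v \<in> dist_matrix_directions N P}"
  note I = finite_upper_pairs[of N]
  have Tsp: "?T r v \<in> space ?M" for r v by (simp add: space_PiM)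
  have ball: "measure (sym0_lebesgue N) (F \<inter> sym0_ball N P r)
      = measure ?M {v \<in> {v \<in> space ?M. ?f v \<in> F}. L2_set (\<lambda>p. v p - P $$ p) ?I < r}"
    if F: "F \<subseteq> dist_matrices N" and Fm: "{v \<in> space ?M. ?f v \<in> F} \<in> sets ?M" for F r
  proof -
    have "L2_set (\<lambda>p. ?f v $$ p - P $$ p) ?I = L2_set (\<lambda>p. v p - P $$ p) ?I" for v
      by (intro L2_set_cong) (auto simp: sym0_of_coords_upper)
    then have eq: "{v \<in> space ?M. ?f v \<in> F \<inter> sym0_ball N P r}
        = {v \<in> {v \<in> space ?M. ?f v \<in> F}. L2_set (\<lambda>p. v p - P $$ p) ?I < r}"
      by (auto simp: sym0_ball_def sym0_of_coords_in_sym0)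
    also have "\<dots> = {v \<in> space ?M. v \<in> {v \<in> space ?M. ?f v \<in> F} \<and> L2_set (\<lambda>p. v p - P $$ p) ?I < r}"
      by auto
    also have "\<dots> \<in> sets ?M"
      using Fm measurable_L2_set_PiM[OF I, of "\<lambda>p. P $$ p"] by measurable
    finally have m: "{v \<in> space ?M. ?f v \<in> F \<inter> sym0_ball N P r} \<in> sets ?M" unfolding eq .
    have "F \<inter> sym0_ball N P r \<subseteq> sym0 N" using F dist_matrices_sub_sym0 by auto
    from emeasure_sym0_lebesgue[OF this m] show ?thesis unfolding eq[symmetric] by (simp add: measure_def)
  qed
  let ?X = "measure ?M {x \<in> ?C. L2_set x ?I < 1}"
  have iff: "\<forall>\<^sub>F r in at_right 0. ?f (?T r v) \<in> dist_matrices N \<longleftrightarrow> ?f v \<in> dist_matrix_directions N P" for v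
    by (rule eventually_dist_matrices_iff[OF P nonneg tri])
  have D: "((\<lambda>r. measure (sym0_lebesgue N) (dist_matrices N \<inter> sym0_ball N P r) / r ^ card ?I) \<longlongrightarrow> ?X) (at_right 0)"
    unfolding ball[OF subset_refl dist_matrices_measurable]
    using AE_space by (intro measure_L2_ball_blow_up I dist_matrices_measurable dist_matrix_directions_measurable)
      (auto elim!: eventually_mono intro!: eventually_mono[OF iff] simp: Tsp)
  have E': "((\<lambda>r. measure (sym0_lebesgue N) (E \<inter> sym0_ball N P r) / r ^ card ?I) \<longlongrightarrow> ?X) (at_right 0)"
    unfolding ball[OF E meas]
  proof (intro measure_L2_ball_blow_up I meas dist_matrix_directions_measurable)
    show "AE v in ?M. \<forall>\<^sub>F r in at_right 0. ?T r v \<in> {v \<in> space ?M. ?f v \<in> E} \<longleftrightarrow> v \<in> ?C"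
      using ray AE_space
    proof eventually_elim
      case (elim v)
      from elim(1) iff[of v] show ?case
        by eventually_elim (use elim(2) E Tsp in auto)
    qed
  qed
  have "?X > 0" by (rule dist_matrix_directions_ball_pos)
  with tendsto_divide[OF E' D] have "((\<lambda>r. (measure (sym0_lebesgue N) (E \<inter> sym0_ball N P r) / r ^ card ?I) /
      (measure (sym0_lebesgue N) (dist_matrices N \<inter> sym0_ball N P r) / r ^ card ?I)) \<longlongrightarrow> 1) (at_right 0)"
    by simp
  moreover have "\<forall>\<^sub>F r in at_right (0::real). (measure (sym0_lebesgue N) (E \<inter> sym0_ball N P r) / r ^ card ?I) /
      (measure (sym0_lebesgue N) (dist_matrices N \<inter> sym0_ball N P r) / r ^ card ?I) =
      measure (sym0_lebesgue N) (E \<inter> sym0_ball N P r) /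
      measure (sym0_lebesgue N) (dist_matrices N \<inter> sym0_ball N P r)"
    using eventually_at_right_less[of 0] by eventually_elim simp
  ultimately have "((\<lambda>r. measure (sym0_lebesgue N) (E \<inter> sym0_ball N P r) /
      measure (sym0_lebesgue N) (dist_matrices N \<inter> sym0_ball N P r)) \<longlongrightarrow> 1) (at_right 0)"
    by (rule Lim_transform_eventually)
  then show ?thesis unfolding rel_density_one_def
    using E dist_matrices_sub_sym0 sets_sym0_lebesgueI[OF _ meas] by blast
qed

text \<open>Adding \<open>t\<close> to all distances makes the determinant a polynomial in \<open>exp (- t)\<close>, with value \<open>1\<close> at
  \<open>exp (- t) = 0\<close>.\<close>

lemma det_zeta_matrix_null:
  "{v \<in> space (coords_lborel N). \<not> det (zeta_matrix (sym0_of_coords N v)) \<noteq> 0} \<in> null_sets (coords_lborel N)"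
  (is "?S \<in> _")
proof (rule null_of_countable_line_sections[OF finite_upper_pairs])
  let ?f = "sym0_of_coords N"
  have "(\<lambda>v. det (zeta_matrix (?f v))) \<in> borel_measurable (coords_lborel N)"
    by (rule measurable_det[of _ N])
      (auto simp: sym0_of_coords_carrier zeta_matrix_carrier zeta_matrix_index[OF sym0_of_coords_carrier]
        intro!: borel_measurable_exp borel_measurable_uminus measurable_sym0_of_coords_index)
  then show "?S \<in> sets (coords_lborel N)" by measurable
  fix v
  let ?a = "\<lambda>k l. if k = l then 1 else 0 :: real"
  \<comment> \<open>The diagonal entries stay 1 along the line because only off-diagonal distances
    are shifted.\<close>
  let ?c = "\<lambda>k l. if k = l then 0 else exp (- ?f v $$ (k, l))"
  let ?B = "{\<mu>. det (mat N N (\<lambda>(k, l). ?a k l + \<mu> * ?c k l)) = 0}"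
  have "mat N N (\<lambda>(k, l). ?a k l) = (1\<^sub>m N :: real mat)" by (intro eq_matI) auto
  then have B: "finite ?B" by (intro finite_zeros_det_affine) simp
  have "zeta_matrix (?f (\<lambda>p\<in>upper_pairs N. v p + t * 1)) = mat N N (\<lambda>(k, l). ?a k l + exp (- t) * ?c k l)" for t
    by (intro eq_matI)
      (auto simp: zeta_matrix_def sym0_of_coords_def upper_pairs_def exp_minus exp_add field_simps)
  then have "{t. (\<lambda>p\<in>upper_pairs N. v p + t * 1) \<in> ?S} \<subseteq> (\<lambda>\<mu>. - ln \<mu>) ` ?B"
    by (auto intro!: image_eqI[where x = "exp (- _)"])
  with B show "countable {t. (\<lambda>p\<in>upper_pairs N. v p + t * 1) \<in> ?S}"
    by (meson countable_finite finite_imageI finite_subset)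
qed

text \<open>Every line in the direction of the star meets the singular set in finitely many points,
  so the criterion by line sections applies.\<close>

lemma (in cluster_map) limit_system_null:
  assumes z: "det (mat n n (\<lambda>(i, j). z i j)) \<noteq> 0" and diag: "\<And>i. i < n \<Longrightarrow> z i i \<noteq> 0"
  shows "{v \<in> space (coords_lborel N).
    det (mat N N (\<lambda>(k, l). limit_system z (\<lambda>k l. sym0_of_coords N v $$ (k, l)) k l)) = 0}
      \<in> null_sets (coords_lborel N)" (is "?S \<in> _")
proof (rule null_of_countable_line_sections[OF finite_upper_pairs])
  let ?f = "sym0_of_coords N"
  let ?L = "\<lambda>v. mat N N (\<lambda>(k, l). limit_system z (\<lambda>k l. ?f v $$ (k, l)) k l)"
  have "(\<lambda>v. limit_system z (\<lambda>k l. ?f v $$ (k, l)) k l) \<in> borel_measurable (coords_lborel N)"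
    if "k < N" "l < N" for k l
    unfolding limit_system_def second_diff_def
    by (cases "rep k = k"; cases "rep l = l")
      (auto intro!: borel_measurable_times borel_measurable_diff measurable_sym0_of_coords_index
         simp: that rep_less)
  then have "(\<lambda>v. det (?L v)) \<in> borel_measurable (coords_lborel N)"
    by (intro measurable_det[of _ N]) auto
  then show "?S \<in> sets (coords_lborel N)" by measurable
  fix v
  \<comment> \<open>The coordinates of \<open>star\<close> above the diagonal.\<close>
  let ?u = "\<lambda>p. star_height (fst p) + star_height (snd p)"
  have u: "?f ?u $$ (k, l) = star k l" if "k < N" "l < N" for k l
    using that by (auto simp: sym0_of_coords_index star_def)
  have "?L (\<lambda>p\<in>upper_pairs N. v p + t * ?u p) =
      mat N N (\<lambda>(k, l). limit_system z (\<lambda>k l. ?f v $$ (k, l) + t * star k l) k l)" for t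
    by (intro eq_matI)
      (auto simp: limit_system_def second_diff_def sym0_of_coords_plus[of _ N _ v t ?u] u rep_less)
  then have "{t. (\<lambda>p\<in>upper_pairs N. v p + t * ?u p) \<in> ?S} \<subseteq>
    {t. det (mat N N (\<lambda>(k, l). limit_system z (\<lambda>k l. ?f v $$ (k, l) + t * star k l) k l)) = 0}"
    by auto
  then show "countable {t. (\<lambda>p\<in>upper_pairs N. v p + t * ?u p) \<in> ?S}"
    by (rule countable_finite[OF finite_subset[OF _ limit_system_finite_zeros[OF z diag]]])
qed


section \<open>Cluster weights\<close>

lemma block_disjoint:
  assumes "k \<in> block s i" "k \<in> block s j"
  shows "i = j"
proof (rule ccontr)
  have mono: "sum s {..<Suc a} \<le> sum s {..<b}" if "a < b" for a b
    using that by (intro sum_mono2) auto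
  assume "i \<noteq> j"
  then consider "i < j" | "j < i" by linarith
  then show False
    using assms mono[of i j] mono[of j i] by cases (auto simp: block_def)
qed

lemma block_index_eq: "k \<in> block s i \<Longrightarrow> block_index s k = i"
  unfolding block_index_def by (rule the_equality) (auto intro: block_disjoint)

lemma ex_block: "k < (\<Sum>i<n. s i) \<Longrightarrow> \<exists>i<n. k \<in> block s i"
proof (induction n)
  case (Suc n)
  show ?case
  proof (cases "k < (\<Sum>i<n. s i)")
    case False
    then have "k \<in> block s n" using Suc.prems by (simp add: block_def)
    then show ?thesis by auto
  next
    case True
    from Suc.IH[OF this] show ?thesis using less_Suc_eq by blast
  qed
qed simp

lemma block_index_less: "k < (\<Sum>i<n. s i) \<Longrightarrow> block_index s k < n"
  using ex_block block_index_eq by blast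

lemma block_subset:
  assumes "i < n" "k \<in> block s i"
  shows "k < (\<Sum>i<n. s i)"
proof -
  have "sum s {..<Suc i} \<le> sum s {..<n}" using assms(1) by (intro sum_mono2) auto
  then show ?thesis using assms(2) by (simp add: block_def)
qed

lemma block_conv_block_index: "i < n \<Longrightarrow> block s i = {k. k < (\<Sum>i<n. s i) \<and> block_index s k = i}"
  using block_subset[of i n _ s] block_index_eq[of _ s] ex_block[of _ s n] by (auto simp: set_eq_iff) metis

text \<open>The representative of a block is its first index, which exists because the block is
  nonempty.\<close>

lemma cluster_map_block_index:
  assumes "\<And>i. i < n \<Longrightarrow> s i > 0"
  shows "cluster_map (\<Sum>i<n. s i) n (block_index s) (\<lambda>i. \<Sum>j<i. s j)"
proof
  have "(\<Sum>j<i. s j) \<in> block s i" if "i < n" for i using assms[OF that] by (simp add: block_def)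
  then show "i < n \<Longrightarrow> (\<Sum>j<i. s j) < (\<Sum>i<n. s i)" "i < n \<Longrightarrow> block_index s (\<Sum>j<i. s j) = i" for i
    by (auto intro: block_subset block_index_eq)
qed (rule block_index_less)

lemma cluster_weight_eq_adj_mat:
  assumes "A \<in> carrier_mat N N" "det (zeta_matrix A) \<noteq> 0" "block s i \<subseteq> {..<N}"
  shows "cluster_weight s i A =
    (\<Sum>k\<in>block s i. (\<Sum>l<N. adj_mat (zeta_matrix A) $$ (k, l)) / det (zeta_matrix A))"
  unfolding cluster_weight_def
  using assms(3) by (intro sum.cong refl weighting_eq_adj_mat[OF assms(1,2)]) auto

text \<open>Where the determinant is nonzero, the cluster weights are rational expressions in the
  entries of the zeta matrix; the conjunct on the determinant permits replacing them by these
  measurable expressions.\<close>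

lemma cluster_weights_near_measurable:
  assumes J: "finite J" "\<And>i. i \<in> J \<Longrightarrow> block s i \<subseteq> {..<N}"
  shows "{v \<in> space (coords_lborel N). sym0_of_coords N v \<in> {A \<in> dist_matrices N.
      det (zeta_matrix A) \<noteq> 0 \<and> (\<forall>i\<in>J. \<bar>cluster_weight s i A - m i\<bar> < \<epsilon>)}} \<in> sets (coords_lborel N)"
proof -
  let ?f = "sym0_of_coords N" and ?M = "coords_lborel N"
  let ?w = "\<lambda>i v. \<Sum>k\<in>block s i. (\<Sum>l<N. adj_mat (zeta_matrix (?f v)) $$ (k, l)) / det (zeta_matrix (?f v))"
  note Z = zeta_matrix_carrier[OF sym0_of_coords_carrier]
  have entry: "(\<lambda>v. zeta_matrix (?f v) $$ (k, l)) \<in> borel_measurable ?M" if "k < N" "l < N" for k l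
    unfolding zeta_matrix_index[OF sym0_of_coords_carrier that]
    using measurable_sym0_of_coords_index[OF that] by measurable
  note det_m = measurable_det[OF Z entry]
  have w_m: "?w i \<in> borel_measurable ?M" if "i \<in> J" for i
    using J(2)[OF that]
    by (intro borel_measurable_sum borel_measurable_divide det_m measurable_adj_mat[OF Z entry]) auto
  have "{v \<in> space ?M. ?f v \<in> {A \<in> dist_matrices N.
      det (zeta_matrix A) \<noteq> 0 \<and> (\<forall>i\<in>J. \<bar>cluster_weight s i A - m i\<bar> < \<epsilon>)}} =
    {v \<in> space ?M. v \<in> {v \<in> space ?M. ?f v \<in> dist_matrices N} \<and>
      det (zeta_matrix (?f v)) \<noteq> 0 \<and> (\<forall>i\<in>J. \<bar>?w i v - m i\<bar> < \<epsilon>)}"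
    using cluster_weight_eq_adj_mat[OF sym0_of_coords_carrier _ J(2)] by auto
  also have "\<dots> \<in> sets ?M"
  proof (intro sets.sets_Collect_conj sets.sets_Collect_finite_All J(1))
    show "{v \<in> space ?M. v \<in> {v \<in> space ?M. ?f v \<in> dist_matrices N}} \<in> sets ?M"
      using dist_matrices_measurable[of N] by simp
    show "{v \<in> space ?M. det (zeta_matrix (?f v)) \<noteq> 0} \<in> sets ?M"
      using det_m by measurable
    show "{v \<in> space ?M. \<bar>?w i v - m i\<bar> < \<epsilon>} \<in> sets ?M" if "i \<in> J" for i
      using w_m[OF that] by measurable
  qed
  finally show ?thesis .
qed

text \<open>The set \<open>J\<close> of clusters is left free: singletons give the limit for each
  cluster, and all indices give the bound on the maximum.\<close>

lemma cluster_weights_rel_density_one: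
  fixes X :: "'a set" and d :: "'a \<Rightarrow> 'a \<Rightarrow> real" and x :: "nat \<Rightarrow> 'a" and s :: "nat \<Rightarrow> nat"
  assumes X: "Metric_space X d" and xX: "\<And>i. i < n \<Longrightarrow> x i \<in> X"
    and inv: "invertible_mat (zeta_matrix (dist_matrix d x n))"
    and s: "\<And>i. i < n \<Longrightarrow> s i > 0"
    and J: "J \<subseteq> {..<n}" and \<epsilon>: "\<epsilon> > 0"
  shows "rel_density_one (\<Sum>i<n. s i) (blow_up s (dist_matrix d x n))
    {A \<in> dist_matrices (\<Sum>i<n. s i). det (zeta_matrix A) \<noteq> 0 \<and>
      (\<forall>i\<in>J. \<bar>cluster_weight s i A - weighting (dist_matrix d x n) $ i\<bar> < \<epsilon>)}"
proof -
  interpret Metric_space X d by (rule X)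
  let ?D = "dist_matrix d x n" and ?N = "\<Sum>i<n. s i" and ?b = "block_index s"
  let ?P = "blow_up s ?D"
  let ?f = "sym0_of_coords ?N" and ?z = "\<lambda>i j. exp (- d (x i) (x j))"
  let ?T = "\<lambda>r v. ?f (\<lambda>p\<in>upper_pairs ?N. ?P $$ p + r * v p)"
  interpret cluster_map ?N n ?b "\<lambda>i. \<Sum>j<i. s j" by (rule cluster_map_block_index[OF s])
  have D: "?D \<in> carrier_mat n n" by (simp add: dist_matrix_def)
  have zD: "zeta_matrix ?D = mat n n (\<lambda>(i, j). ?z i j)"
    by (intro eq_matI) (auto simp: zeta_matrix_def dist_matrix_def)
  have det_z: "det (mat n n (\<lambda>(i, j). ?z i j)) \<noteq> 0"
    using det_nonzero_of_invertible_mat[OF inv zeta_matrix_carrier[OF D]] unfolding zD .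
  have P_index: "?P $$ (k, l) = d (x (?b k)) (x (?b l))" if "k < ?N" "l < ?N" for k l
    using that b_less by (simp add: blow_up_def dist_matrix_def)
  have P: "?P \<in> sym0 ?N"
    using xX b_less D unfolding sym0_def
    by (auto simp: P_index commute) (auto simp: blow_up_def dist_matrix_def)
  have blocks: "block s i \<subseteq> {..<?N}" if "i < n" for i
    using block_subset[OF that] by auto
  show ?thesis
  proof (rule rel_density_oneI[OF P])
    show "0 \<le> ?P $$ (i, j)" if "i < ?N" "j < ?N" for i j
      using that by (simp add: P_index)
    show "?P $$ (i, k) \<le> ?P $$ (i, j) + ?P $$ (j, k)" if "i < ?N" "j < ?N" "k < ?N" for i j k
      using that xX b_less by (simp add: P_index triangle)
    show "{v \<in> space (coords_lborel ?N). ?f v \<in> {A \<in> dist_matrices ?N. det (zeta_matrix A) \<noteq> 0 \<and>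
      (\<forall>i\<in>J. \<bar>cluster_weight s i A - weighting ?D $ i\<bar> < \<epsilon>)}} \<in> sets (coords_lborel ?N)"
      using J blocks by (intro cluster_weights_near_measurable) (auto intro: finite_subset)
    have "AE v in coords_lborel ?N. v \<notin> {v \<in> space (coords_lborel ?N).
        det (mat ?N ?N (\<lambda>(k, l). limit_system ?z (\<lambda>k l. ?f v $$ (k, l)) k l)) = 0}"
      by (rule AE_not_in[OF limit_system_null[OF det_z]]) simp
    then show "AE v in coords_lborel ?N. \<forall>\<^sub>F r in at_right 0. ?T r v \<in> dist_matrices ?N \<longrightarrow>
      ?T r v \<in> {A \<in> dist_matrices ?N. det (zeta_matrix A) \<noteq> 0 \<and>
        (\<forall>i\<in>J. \<bar>cluster_weight s i A - weighting ?D $ i\<bar> < \<epsilon>)}"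
      using AE_space
    proof eventually_elim
      fix v
      let ?e = "\<lambda>k l. ?f v $$ (k, l)"
      let ?Z = "\<lambda>r k l. ?z (?b k) (?b l) * exp (- (r * ?e k l))"
      assume "v \<notin> {v \<in> space (coords_lborel ?N).
          det (mat ?N ?N (\<lambda>(k, l). limit_system ?z (\<lambda>k l. ?f v $$ (k, l)) k l)) = 0}"
        and "v \<in> space (coords_lborel ?N)"
      then have det_L: "det (mat ?N ?N (\<lambda>(k, l). limit_system ?z ?e k l)) \<noteq> 0" by simp
      \<comment> \<open>Along the ray the exponent is a distance in \<open>X\<close> plus
        \<open>r\<close> times the direction, so each entry factors as the perturbation scheme
        requires.\<close>
      have ZT: "mat ?N ?N (\<lambda>(k, l). ?Z r k l) = zeta_matrix (?T r v)" for r
      proof (rule eq_matI)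
        fix k l assume "k < dim_row (zeta_matrix (?T r v))" "l < dim_col (zeta_matrix (?T r v))"
        then have kl: "k < ?N" "l < ?N"
          by (simp_all add: zeta_matrix_def sym0_of_coords_def)
        then show "mat ?N ?N (\<lambda>(k, l). ?Z r k l) $$ (k, l) = zeta_matrix (?T r v) $$ (k, l)"
          by (simp add: zeta_matrix_index[OF sym0_of_coords_carrier] sym0_of_coords_affine[OF P]
              P_index flip: exp_add)
      qed (auto simp: zeta_matrix_def sym0_of_coords_def)
      have x_eq: "(\<Sum>j<n. ?z i j * weighting ?D $ j) = 1" if "i < n" for i
        using weighting_equation[OF D _ that] det_z that by (simp add: zD)
      have w_eq: "(\<Sum>l<?N. ?Z r k l * weighting (?T r v) $ l) = 1"
        if "det (mat ?N ?N (\<lambda>(k, l). ?Z r k l)) \<noteq> 0" "k < ?N" for r k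
      proof -
        have "(\<Sum>l<?N. zeta_matrix (?T r v) $$ (k, l) * weighting (?T r v) $ l) = 1"
          by (rule weighting_equation[OF sym0_of_coords_carrier _ that(2)]) (use that(1) ZT in simp)
        then show ?thesis unfolding ZT[symmetric] using that(2) by simp
      qed
      note lim = cluster_sums_tendsto[OF det_z det_L x_eq w_eq]
      have "\<forall>\<^sub>F r in at_right 0. \<forall>i\<in>J. dist (cluster_weight s i (?T r v)) (weighting ?D $ i) < \<epsilon>"
      proof (intro eventually_ball_finite ballI)
        show "finite J" using J finite_subset by blast
        fix i assume "i \<in> J"
        then have i: "i < n" using J by auto
        from tendstoD[OF lim(2)[OF _ _ _ i] \<epsilon>]
        show "\<forall>\<^sub>F r in at_right 0. dist (cluster_weight s i (?T r v)) (weighting ?D $ i) < \<epsilon>"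
          unfolding cluster_weight_def block_conv_block_index[OF i] .
      qed
      moreover have "\<forall>\<^sub>F r in at_right 0. det (zeta_matrix (?T r v)) \<noteq> 0"
        using lim(1) unfolding ZT by simp
      ultimately show "\<forall>\<^sub>F r in at_right 0. ?T r v \<in> dist_matrices ?N \<longrightarrow>
        ?T r v \<in> {A \<in> dist_matrices ?N. det (zeta_matrix A) \<noteq> 0 \<and>
          (\<forall>i\<in>J. \<bar>cluster_weight s i A - weighting ?D $ i\<bar> < \<epsilon>)}"
        by eventually_elim (simp add: dist_real_def)
    qed
  qed auto
qed

theorem theorem4p4:
  fixes X :: "'a set" and d :: "'a \<Rightarrow> 'a \<Rightarrow> real" and x :: "nat \<Rightarrow> 'a"
    and n :: nat and s :: "nat \<Rightarrow> nat"
  assumes "Metric_space X d"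
    and "n \<ge> 1"
    and "bij_betw x {..<n} X"
    and "invertible_mat (zeta_matrix (dist_matrix d x n))"
    and "\<And>i. i < n \<Longrightarrow> s i > 0"
  shows "(\<forall>i<n. strat_approx_limit (dist_matrix d x n) s
            (\<lambda>A. if det (zeta_matrix A) \<noteq> 0 then Some (cluster_weight s i A) else None)
            (weighting (dist_matrix d x n) $ i)) \<and>
         (\<forall>\<epsilon>>0. rel_density_one (\<Sum>i<n. s i) (blow_up s (dist_matrix d x n))
            {A \<in> dist_matrices (\<Sum>i<n. s i). det (zeta_matrix A) \<noteq> 0 \<and>
               Max ((\<lambda>i. \<bar>cluster_weight s i A - weighting (dist_matrix d x n) $ i\<bar>) ` {..<n}) < \<epsilon>})"
proof (intro conjI allI impI)
  have xX: "x i \<in> X" if "i < n" for i using assms(3) that by (auto simp: bij_betw_def)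
  let ?N = "\<Sum>i<n. s i"
  have density: "rel_density_one ?N (blow_up s (dist_matrix d x n))
      {A \<in> dist_matrices ?N. det (zeta_matrix A) \<noteq> 0 \<and>
        (\<forall>i\<in>J. \<bar>cluster_weight s i A - weighting (dist_matrix d x n) $ i\<bar> < \<epsilon>)}"
    if "J \<subseteq> {..<n}" "\<epsilon> > 0" for J \<epsilon>
    by (rule cluster_weights_rel_density_one[of X d n x s, OF assms(1) xX assms(4,5) that])
  show "strat_approx_limit (dist_matrix d x n) s
      (\<lambda>A. if det (zeta_matrix A) \<noteq> 0 then Some (cluster_weight s i A) else None)
      (weighting (dist_matrix d x n) $ i)" if i: "i < n" for i
  proof -
    have dim: "dim_row (dist_matrix d x n) = n" by (simp add: dist_matrix_def)
    have "AE A in sym0_lebesgue ?N. det (zeta_matrix A) \<noteq> 0"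
      by (rule AE_sym0_lebesgueI[OF det_zeta_matrix_null])
    \<comment> \<open>The zeta determinant is nonzero almost everywhere on the whole space, so the
      radius 1 is an arbitrary choice.\<close>
    then have "AE A in sym0_lebesgue ?N. A \<in> dist_matrices ?N \<inter> sym0_ball ?N (blow_up s (dist_matrix d x n)) 1 \<longrightarrow>
        (if det (zeta_matrix A) \<noteq> 0 then Some (cluster_weight s i A) else None) \<noteq> None"
      by eventually_elim simp
    moreover have "rel_density_one ?N (blow_up s (dist_matrix d x n)) {A \<in> dist_matrices ?N.
        \<exists>v. (if det (zeta_matrix A) \<noteq> 0 then Some (cluster_weight s i A) else None) = Some v \<and>
          dist v (weighting (dist_matrix d x n) $ i) < \<epsilon>}" if "\<epsilon> > 0" for \<epsilon>
    proof -
      have "{A \<in> dist_matrices ?N.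
        \<exists>v. (if det (zeta_matrix A) \<noteq> 0 then Some (cluster_weight s i A) else None) = Some v \<and>
          dist v (weighting (dist_matrix d x n) $ i) < \<epsilon>} = {A \<in> dist_matrices ?N. det (zeta_matrix A) \<noteq> 0 \<and>
          (\<forall>i\<in>{i}. \<bar>cluster_weight s i A - weighting (dist_matrix d x n) $ i\<bar> < \<epsilon>)}"
        by (intro Collect_cong conj_cong refl) (simp add: dist_real_def)
      moreover have "rel_density_one ?N (blow_up s (dist_matrix d x n)) \<dots>"
        by (rule density[of "{i}", OF _ that]) (use i in simp)
      ultimately show ?thesis by (rule ssubst)
    qed
    ultimately show ?thesis
      unfolding strat_approx_limit_def Let_def dim
      by (intro conjI exI[of _ 1] allI impI) simp_all
  qed
  show "rel_density_one ?N (blow_up s (dist_matrix d x n))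
      {A \<in> dist_matrices ?N. det (zeta_matrix A) \<noteq> 0 \<and>
        Max ((\<lambda>i. \<bar>cluster_weight s i A - weighting (dist_matrix d x n) $ i\<bar>) ` {..<n}) < \<epsilon>}"
    if "\<epsilon> > 0" for \<epsilon>
  proof -
    \<comment> \<open>A bound on \<open>Max\<close> unfolds to bounds on all elements only for a
      nonempty set, which is where \<open>n \<ge> 1\<close> enters.\<close>
    have "{..<n} \<noteq> {}" using assms(2) by (auto simp: lessThan_empty_iff)
    then have "{A \<in> dist_matrices ?N. det (zeta_matrix A) \<noteq> 0 \<and>
        Max ((\<lambda>i. \<bar>cluster_weight s i A - weighting (dist_matrix d x n) $ i\<bar>) ` {..<n}) < \<epsilon>}
      = {A \<in> dist_matrices ?N. det (zeta_matrix A) \<noteq> 0 \<and>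
        (\<forall>i\<in>{..<n}. \<bar>cluster_weight s i A - weighting (dist_matrix d x n) $ i\<bar> < \<epsilon>)}"
      by simp
    moreover have "rel_density_one ?N (blow_up s (dist_matrix d x n)) \<dots>"
      by (rule density[OF subset_refl that])
    ultimately show ?thesis by (rule ssubst)
  qed
qed

end
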